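(* Given a pair of time series $A$ and $B$ with $|A|\le|B|$ (and their dissimilarity values), the periodic DTW distance problem can be solved in $O(\max(|A|\log|B|,|B|)\,|B|\log|B|)$ time and $O(|A||B|)$ space.
   Context: A time series is a nonempty finite sequence; $|S|$ is the length of $S$, $S[i]$ its $i$-th element (1-indexed), $S[a:b]=S[a]\circ\cdots\circ S[b]$, and $\circ$ is concatenation. For time series $A,B$, $d_{A,B}(i,j)$ is the dissimilarity of $A[i]$ and $B[j]$; standing assumption: every dissimilarity value is an integer in $\{0,1,\dots,c\}$ where $c=O(1)$ is a constant independent of the lengths. An alignment of $A[i_\vdash:i_\dashv]$ and $B[j_\vdash:j_\dashv]$ is a sequence of index pairs $(i_1,j_1)\circ\cdots\circ(i_m,j_m)$ with $(i_1,j_1)=(i_\vdash,j_\vdash)$, $(i_m,j_m)=(i_\dashv,j_\dashv)$, and each step $(i_k,j_k)-(i_{k-1},j_{k-1})\in\{(1,1),(1,0),(0,1)\}$; its discrepancy is $\sum_k d_{A,B}(i_k,j_k)$, and $\mathrm{DTW}(A[i_\vdash:i_\dashv],B[j_\vdash:j_\dashv])$ is the minimum discrepancy over all alignments. The periodic DTW distance problem: given $A,B$ with $|A|\le|B|$, find a quadruple consisting of a nonnegative integer $\ell$, a decomposition $B=B_0\circ B_1\circ\cdots\circ B_\ell$ of $B$ into contiguous subsequences, and indices $i_\vdash,i_\dashv$ with $1\le i_\vdash,i_\dashv\le|A|$, that minimizes $\mathrm{DTW}(A[i_\vdash:i_\dashv],B)$ if $\ell=0$, and $\mathrm{DTW}(A[i_\vdash:|A|],B_0)+\sum_{k=1}^{\ell-1}\mathrm{DTW}(A,B_k)+\mathrm{DTW}(A[1:i_\dashv],B_\ell)$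 otherwise. *)

theory Defs
  imports Complex_Main "HOL-Library.Landau_Symbols"
begin

section \<open>Dynamic time warping\<close>

text \<open>
  Time series are nonempty lists, and \<open>\<delta> x y\<close> is the dissimilarity of the elements \<open>x\<close> and \<open>y\<close>.
  Indices are 1-based.
\<close>

definition dissim :: "('a \<Rightarrow> 'a \<Rightarrow> nat) \<Rightarrow> 'a list \<Rightarrow> 'a list \<Rightarrow> nat \<Rightarrow> nat \<Rightarrow> nat" where
  "dissim \<delta> A B i j = \<delta> (A ! (i - 1)) (B ! (j - 1))"

definition alignment_step :: "nat \<times> nat \<Rightarrow> nat \<times> nat \<Rightarrow> bool" where
  "alignment_step u v \<longleftrightarrow>
     v \<in> {(fst u + 1, snd u + 1), (fst u + 1, snd u), (fst u, snd u + 1)}"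

text \<open>Alignments of the index ranges \<open>[i1 : i2]\<close> and \<open>[j1 : j2]\<close>.\<close>

definition alignment :: "nat \<Rightarrow> nat \<Rightarrow> nat \<Rightarrow> nat \<Rightarrow> (nat \<times> nat) list \<Rightarrow> bool" where
  "alignment i1 i2 j1 j2 P \<longleftrightarrow>
     P \<noteq> [] \<and> hd P = (i1, j1) \<and> last P = (i2, j2) \<and> successively alignment_step P"

definition discrepancy ::
    "('a \<Rightarrow> 'a \<Rightarrow> nat) \<Rightarrow> 'a list \<Rightarrow> 'a list \<Rightarrow> (nat \<times> nat) list \<Rightarrow> nat" where
  "discrepancy \<delta> A B P = (\<Sum>(i, j)\<leftarrow>P. dissim \<delta> A B i j)"

text \<open>
  \<open>DTW \<delta> A i1 i2 B j1 j2\<close> is the distance of \<open>A[i1 : i2]\<close> and \<open>B[j1 : j2]\<close>.  It is only used for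
  nonempty ranges; then alignments exist, so that \<^const>\<open>Inf\<close> on \<^typ>\<open>nat\<close> is an attained minimum.
\<close>

definition DTW ::
    "('a \<Rightarrow> 'a \<Rightarrow> nat) \<Rightarrow> 'a list \<Rightarrow> nat \<Rightarrow> nat \<Rightarrow> 'a list \<Rightarrow> nat \<Rightarrow> nat \<Rightarrow> nat" where
  "DTW \<delta> A i1 i2 B j1 j2 = Inf {discrepancy \<delta> A B P | P. alignment i1 i2 j1 j2 P}"


section \<open>The periodic DTW distance problem\<close>

text \<open>
  A candidate \<open>(l, Bs, i, i')\<close> consists of the number \<open>l\<close>, the list \<open>Bs = [B\<^sub>0, \<dots>, B\<^sub>l]\<close> of the
  pieces of the decomposition, and the start and end index in \<open>A\<close>.  The pieces are time series, hence
  nonempty.  For \<open>l = 0\<close> the range \<open>A[i : i']\<close> is a time series as well, hence \<open>i \<le> i'\<close>.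
\<close>

type_synonym 'a candidate = "nat \<times> 'a list list \<times> nat \<times> nat"

definition feasible :: "'a list \<Rightarrow> 'a list \<Rightarrow> 'a candidate \<Rightarrow> bool" where
  "feasible A B = (\<lambda>(l, Bs, i, i').
     length Bs = l + 1 \<and> [] \<notin> set Bs \<and> concat Bs = B \<and>
     1 \<le> i \<and> i \<le> length A \<and> 1 \<le> i' \<and> i' \<le> length A \<and> (l = 0 \<longrightarrow> i \<le> i'))"

definition periodic_cost ::
    "('a \<Rightarrow> 'a \<Rightarrow> nat) \<Rightarrow> 'a list \<Rightarrow> 'a list \<Rightarrow> 'a candidate \<Rightarrow> nat" where
  "periodic_cost \<delta> A B = (\<lambda>(l, Bs, i, i').
     if l = 0 then DTW \<delta> A i i' B 1 (length B)
     else DTW \<delta> A i (length A) (Bs ! 0) 1 (length (Bs ! 0))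
        + (\<Sum>k = 1..l - 1. DTW \<delta> A 1 (length A) (Bs ! k) 1 (length (Bs ! k)))
        + DTW \<delta> A 1 i' (Bs ! l) 1 (length (Bs ! l)))"

definition periodic_DTW_solution ::
    "('a \<Rightarrow> 'a \<Rightarrow> nat) \<Rightarrow> 'a list \<Rightarrow> 'a list \<Rightarrow> 'a candidate \<Rightarrow> bool" where
  "periodic_DTW_solution \<delta> A B q \<longleftrightarrow>
     feasible A B q \<and> (\<forall>q'. feasible A B q' \<longrightarrow> periodic_cost \<delta> A B q \<le> periodic_cost \<delta> A B q')"


section \<open>A word RAM\<close>

text \<open>
  Structured programs over registers and a random-access memory, both holding natural numbers.  Every
  instruction and every test of a branch or loop takes one unit of time.  A program is a finite object,
  so it mentions only finitely many registers, independently of its input.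
\<close>

datatype binop = Plus | Minus | Times | Divide

fun apply_binop :: "binop \<Rightarrow> nat \<Rightarrow> nat \<Rightarrow> nat" where
  "apply_binop Plus x y = x + y"
| "apply_binop Minus x y = x - y"
| "apply_binop Times x y = x * y"
| "apply_binop Divide x y = x div y"

datatype prog =
    Skip
  | Const nat nat              \<comment> \<open>\<open>r := k\<close>\<close>
  | Op binop nat nat nat       \<comment> \<open>\<open>r := x \<circ> y\<close>\<close>
  | Load nat nat               \<comment> \<open>\<open>r := mem[a]\<close>\<close>
  | Store nat nat              \<comment> \<open>\<open>mem[a] := r\<close>\<close>
  | Seq prog prog
  | IfLess nat nat prog prog   \<comment> \<open>if \<open>x < y\<close> then, else\<close>
  | WhileLess nat nat prog     \<comment> \<open>while \<open>x < y\<close> do\<close>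

text \<open>The contents of the registers and of the memory.\<close>

type_synonym state = "(nat \<Rightarrow> nat) \<times> (nat \<Rightarrow> nat)"

text \<open>
  \<open>exec w S p s t s'\<close>: on a machine with words of \<open>w\<close> bits and a memory of \<open>S\<close> words, \<open>p\<close> started in
  \<open>s\<close> halts in \<open>s'\<close> after \<open>t\<close> units of time.  There is no such run if a value of more than \<open>w\<close> bits
  would be put into a register or a memory address \<open>\<ge> S\<close> would be accessed.
\<close>

inductive exec :: "nat \<Rightarrow> nat \<Rightarrow> prog \<Rightarrow> state \<Rightarrow> nat \<Rightarrow> state \<Rightarrow> bool" for w S :: nat where
  Skip: "exec w S Skip s 1 s"
| Const: "k < 2 ^ w \<Longrightarrow> exec w S (Const r k) (R, M) 1 (R(r := k), M)"
| Op: "apply_binop f (R x) (R y) < 2 ^ w \<Longrightarrow>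
    exec w S (Op f r x y) (R, M) 1 (R(r := apply_binop f (R x) (R y)), M)"
| Load: "R a < S \<Longrightarrow> M (R a) < 2 ^ w \<Longrightarrow> exec w S (Load r a) (R, M) 1 (R(r := M (R a)), M)"
| Store: "R a < S \<Longrightarrow> exec w S (Store a r) (R, M) 1 (R, M(R a := R r))"
| Seq: "exec w S p s t s' \<Longrightarrow> exec w S q s' t' s'' \<Longrightarrow> exec w S (Seq p q) s (t + t') s''"
| IfTrue: "fst s x < fst s y \<Longrightarrow> exec w S p s t s' \<Longrightarrow> exec w S (IfLess x y p q) s (1 + t) s'"
| IfFalse: "\<not> fst s x < fst s y \<Longrightarrow> exec w S q s t s' \<Longrightarrow> exec w S (IfLess x y p q) s (1 + t) s'"
| WhileFalse: "\<not> fst s x < fst s y \<Longrightarrow> exec w S (WhileLess x y p) s 1 s"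
| WhileTrue: "fst s x < fst s y \<Longrightarrow> exec w S p s t s' \<Longrightarrow> exec w S (WhileLess x y p) s' t' s'' \<Longrightarrow>
    exec w S (WhileLess x y p) s (1 + t + t') s''"

inductive_cases exec_SkipE: "exec w S Skip s t s'"
inductive_cases exec_ConstE: "exec w S (Const r k) s t s'"
inductive_cases exec_OpE: "exec w S (Op f r x y) s t s'"
inductive_cases exec_LoadE: "exec w S (Load r a) s t s'"
inductive_cases exec_StoreE: "exec w S (Store a r) s t s'"
inductive_cases exec_SeqE: "exec w S (Seq p q) s t s'"
inductive_cases exec_IfE: "exec w S (IfLess x y p q) s t s'"
inductive_cases exec_WhileE: "exec w S (WhileLess x y p) s t s'"

lemma exec_deterministic:
  "exec w S p s t s' \<Longrightarrow> exec w S p s u s'' \<Longrightarrow> t = u \<and> s' = s''"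
proof (induction arbitrary: u s'' rule: exec.induct)
  case (Skip s)
  then show ?case by (rule exec_SkipE) simp
next
  case (Const k r R M)
  from Const.prems show ?case by (rule exec_ConstE) simp
next
  case (Op f R x y r M)
  from Op.prems show ?case by (rule exec_OpE) simp
next
  case (Load R a M r)
  from Load.prems show ?case by (rule exec_LoadE) simp
next
  case (Store R a r M)
  from Store.prems show ?case by (rule exec_StoreE) simp
next
  case (Seq p s t s1 q t' s2)
  from Seq.prems obtain a b r where
    "exec w S p s a r" "exec w S q r b s''" and "u = a + b"
    by (rule exec_SeqE)
  with Seq.IH(1)[of a r] Seq.IH(2)[of b s''] show ?case by simp
next
  case (IfTrue s x y p t s1 q)
  from IfTrue.prems IfTrue.hyps(1) obtain a where
    "exec w S p s a s''" and "u = 1 + a"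
    by (cases rule: exec_IfE) auto
  with IfTrue.IH[of a s''] show ?case by simp
next
  case (IfFalse s x y q t s1 p)
  from IfFalse.prems IfFalse.hyps(1) obtain a where
    "exec w S q s a s''" and "u = 1 + a"
    by (cases rule: exec_IfE) auto
  with IfFalse.IH[of a s''] show ?case by simp
next
  case (WhileFalse s x y p)
  from WhileFalse.prems WhileFalse.hyps show ?case by (cases rule: exec_WhileE) auto
next
  case (WhileTrue s x y p t s1 t' s2)
  from WhileTrue.prems WhileTrue.hyps(1) obtain a b r where
    "exec w S p s a r" "exec w S (WhileLess x y p) r b s''" and "u = 1 + a + b"
    by (cases rule: exec_WhileE) auto
  with WhileTrue.IH(1)[of a r] WhileTrue.IH(2)[of b s''] show ?case by simp
qed

text \<open>
  The input is placed at the beginning of the memory: the two lengths, followed by the matrix of the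
  dissimilarity values row by row.  Everything else is initially zero.
\<close>

definition input_words :: "('a \<Rightarrow> 'a \<Rightarrow> nat) \<Rightarrow> 'a list \<Rightarrow> 'a list \<Rightarrow> nat list" where
  "input_words \<delta> A B = length A # length B # [\<delta> a b. a \<leftarrow> A, b \<leftarrow> B]"

definition initial_state :: "nat list \<Rightarrow> state" where
  "initial_state xs = ((\<lambda>r. 0), (\<lambda>a. if a < length xs then xs ! a else 0))"

text \<open>The output is left at the beginning of the memory; pieces are given by their lengths.\<close>

definition output_words :: "'a candidate \<Rightarrow> nat list" where
  "output_words = (\<lambda>(l, Bs, i, i'). l # i # i' # map length Bs)"

definition outputs :: "state \<Rightarrow> nat list \<Rightarrow> bool" where
  "outputs s ys \<longleftrightarrow> (\<forall>k < length ys. snd s k = ys ! k)"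

end

theory Submission
  imports Defs
begin

text \<open>
  Gluing alignments of the pieces together turns a candidate into a walk on the grid of pairs
  \<open>(i, j)\<close> from the first to the last column of \<^term>\<open>B\<close>.  It may start and end in any row,
  uses alignment steps, and may also go from \<open>(|A|, j)\<close> to \<open>(1, j + 1)\<close>: the pieces are disjoint, so
  returning to the start of \<^term>\<open>A\<close> consumes an element of \<^term>\<open>B\<close>.  Hence this cyclic grid is
  acyclic as a directed graph, and plain dynamic programming finds the cheapest walk in time
  \<open>O(|A| |B|)\<close>, which is within the claimed bound.  The table holds the optimal cost from each cell to
  the last column, so tracing the walk yields the pieces from first to last, in output order.
\<close>

section \<open>Optimal continuations on the grid\<close>

text \<open>Walks and candidates are compared by two inequalities rather than by a bijection.
  \<open>opt\<close> at the first cell bounds every candidate from below, because along each step of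
  an alignment \<open>opt\<close> drops by at most the dissimilarity just paid. Conversely, the
  lengths read off a walk form a candidate that costs at most as much as the walk. That some walk
  attains \<open>opt\<close> is not established beforehand: it comes out of the invariant of the
  tracing loop. The constant \<open>c\<close> enters through the word size. By staying in one row
  the last column is reached at a cost of at most \<open>c\<close> per column, so all table entries
  are at most \<open>c * n\<close> and fit into O(log n) bits. Only costs are tabulated. The moves
  are recomputed from them, so tracing reads no dissimilarities and the output may overwrite the
  input.\<close>

locale periodic_instance =
  fixes \<delta> :: "'a \<Rightarrow> 'a \<Rightarrow> nat" and A B :: "'a list" and c :: nat
  assumes A_nonempty: "A \<noteq> []" and B_nonempty: "B \<noteq> []"
    and dissim_bound: "\<And>a b. a \<in> set A \<Longrightarrow> b \<in> set B \<Longrightarrow> \<delta> a b \<le> c"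
begin

abbreviation "m \<equiv> length A"
abbreviation "n \<equiv> length B"

lemma m_pos: "0 < m" and n_pos: "0 < n"
  using A_nonempty B_nonempty by auto

text \<open>Cells are numbered from 0, column by column: \<open>k mod m\<close> is the row and
  \<open>k div m\<close> the column, both counted from 0. Moves become additions of
  \<open>1\<close>, \<open>m\<close> or \<open>m + 1\<close>, the first column is
  \<open>k < m\<close>, and the last column begins at \<open>m * n - m\<close>.\<close>

definition cell :: "nat \<Rightarrow> nat \<Rightarrow> nat" where
  "cell i j = (j - 1) * m + (i - 1)"

definition dis :: "nat \<Rightarrow> nat" where
  "dis k = dissim \<delta> A B (k mod m + 1) (k div m + 1)"

lemma cell_div_mod:
  assumes "1 \<le> i" "i \<le> m"
  shows "cell i j mod m = i - 1" "cell i j div m = j - 1"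
proof -
  have "i - 1 < m" using assms by simp
  then show "cell i j mod m = i - 1" "cell i j div m = j - 1" using A_nonempty by (simp_all add: cell_def)
qed

lemma cell_bounds:
  assumes "1 \<le> i" "i \<le> m" "1 \<le> j"
  shows "cell i j < m * n \<longleftrightarrow> j \<le> n" "cell i j < m * n - m \<longleftrightarrow> j < n"
proof -
  have *: "cell i j < m * q \<longleftrightarrow> j \<le> q" for q
  proof -
    have "cell i j < m * q \<longleftrightarrow> cell i j div m < q"
      using m_pos by (simp add: div_less_iff_less_mult mult.commute)
    then show ?thesis using assms by (auto simp: cell_div_mod)
  qed
  show "cell i j < m * n \<longleftrightarrow> j \<le> n" by (rule *)
  have "m * n - m = m * (n - 1)" by (simp add: diff_mult_distrib2)
  then show "cell i j < m * n - m \<longleftrightarrow> j < n"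
    using *[of "n - 1"] n_pos assms by auto
qed

lemma dis_cell: "\<lbrakk>1 \<le> i; i \<le> m; 1 \<le> j\<rbrakk> \<Longrightarrow> dis (cell i j) = dissim \<delta> A B i j"
  by (simp add: dis_def cell_div_mod)

lemma dis_le: "k < m * n \<Longrightarrow> dis k \<le> c"
  using m_pos unfolding dis_def dissim_def
  by (auto intro!: dissim_bound nth_mem simp: div_less_iff_less_mult mult.commute)

text \<open>
  Both the move down a column and the move from the bottom of a column to the top of the next one,
  which starts a new piece of \<^term>\<open>B\<close>, go from \<open>k\<close> to \<open>k + 1\<close>.  The codes are \<open>0\<close> for a move
  down, \<open>1\<close> for a move that enlarges the current piece, and \<open>2\<close> for a move to a new piece.
\<close>

definition move :: "nat \<Rightarrow> nat \<Rightarrow> nat \<Rightarrow> bool" where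
  "move k t k' \<longleftrightarrow>
     t = 0 \<and> Suc (k mod m) < m \<and> k' = k + 1 \<or>
     t = 1 \<and> (k' = k + m \<or> Suc (k mod m) < m \<and> k' = k + m + 1) \<or>
     t = 2 \<and> Suc (k mod m) = m \<and> k' = k + 1"

lemma move_less: "move k t k' \<Longrightarrow> k < k'"
  using m_pos by (auto simp: move_def)

text \<open>The only number before the last column whose diagonal successor would leave the grid is
  \<open>m * (n - 1) - 1\<close>, and that cell lies in the last row because \<open>m\<close>
  divides its successor.\<close>

lemma Suc_less_of_not_last_row:
  assumes "k < m * n - m" "Suc (k mod m) < m"
  shows "Suc (k + m) < m * n"
proof -
  have "Suc k \<noteq> m * (n - 1)"
  proof
    assume "Suc k = m * (n - 1)"
    then have "Suc k mod m = 0" by simp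
    then show False using assms(2) by (simp add: mod_Suc split: if_splits)
  qed
  then show ?thesis using assms(1) by (simp add: diff_mult_distrib2)
qed

lemma move_bound: "\<lbrakk>move k t k'; k < m * n - m\<rbrakk> \<Longrightarrow> k' < m * n"
  using m_pos Suc_less_of_not_last_row[of k] by (auto simp: move_def)

text \<open>No move leads into an earlier cell, so one backward sweep computes the optimal continuations.\<close>

function opt :: "nat \<Rightarrow> nat" where
  "opt k = (if k < m * n - m
     then dis k + min (min (opt (k + 1)) (opt (k + m)))
       (if Suc (k mod m) < m then opt (k + m + 1) else opt (k + m))
     else dis k)"
  by auto
termination
  by (relation "measure (\<lambda>k. m * n - k)") (use m_pos in \<open>auto simp del: length_greater_0_conv\<close>)

declare opt.simps [simp del]

text \<open>This base case is the right one because a walk may end in any row and dissimilarities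
  are nonnegative: going further down the last column cannot pay off.\<close>

lemma opt_last_column: "m * n - m \<le> k \<Longrightarrow> opt k = dis k"
  by (subst opt.simps) simp

lemma opt_le_move: "\<lbrakk>move k t k'; k < m * n - m\<rbrakk> \<Longrightarrow> opt k \<le> dis k + opt k'"
  by (subst opt.simps) (auto simp: move_def)

text \<open>Moving along the row of \<open>k\<close> visits \<open>n - k div m\<close> columns and
  pays at most \<open>c\<close> in each. This is what keeps the table entries within a word.\<close>

lemma opt_bound: "k < m * n \<Longrightarrow> opt k \<le> c * (n - k div m)"
proof (induction k rule: opt.induct)
  case (1 k)
  show ?case
  proof (cases "k < m * n - m")
    case True
    then have "k + m < m * n" by simp
    have "(k + m) div m = k div m + 1"
      using A_nonempty by simp
    moreover have "(k + m) div m < n"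
      using \<open>k + m < m * n\<close> less_mult_imp_div_less[of "k + m" n m] by (simp add: mult.commute)
    ultimately have *: "n - k div m = Suc (n - (k + m) div m)" by linarith
    have "opt k \<le> dis k + opt (k + m)"
      by (rule opt_le_move[OF _ True, of 1]) (simp add: move_def)
    also have "\<dots> \<le> c + c * (n - (k + m) div m)"
      using "1.IH"(2)[OF True] \<open>k + m < m * n\<close> dis_le[OF "1.prems"] by (intro add_mono) auto
    finally show ?thesis unfolding * by simp
  next
    case False
    have "k div m < n" using "1.prems" m_pos by (simp add: div_less_iff_less_mult mult.commute)
    then have "1 \<le> n - k div m" by simp
    then have "c * 1 \<le> c * (n - k div m)" by (rule mult_le_mono2)
    moreover have "opt k \<le> c * 1"
      using False dis_le[OF "1.prems"] by (simp add: opt_last_column)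
    ultimately show ?thesis by (rule order.trans[rotated])
  qed
qed

lemma opt_le: "k < m * n \<Longrightarrow> opt k \<le> c * n"
  using opt_bound[of k] by (meson diff_le_self le_trans mult_le_mono2)

end


section \<open>Alignments\<close>

lemma alignment_Cons:
  "alignment i1 i2 j1 j2 (u # P) \<longleftrightarrow> u = (i1, j1) \<and>
     (P = [] \<and> i1 = i2 \<and> j1 = j2 \<or>
      (\<exists>i j. alignment_step (i1, j1) (i, j) \<and> alignment i i2 j j2 P))"
  by (cases P) (auto simp: alignment_def)

lemma alignment_Nil [simp]: "\<not> alignment i1 i2 j1 j2 []"
  by (simp add: alignment_def)

lemma alignment_le: "alignment i1 i2 j1 j2 P \<Longrightarrow> i1 \<le> i2 \<and> j1 \<le> j2"
proof (induction P arbitrary: i1 j1)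
  case (Cons u P)
  then show ?case by (fastforce simp: alignment_Cons alignment_step_def)
qed simp

lemma alignment_exists:
  assumes "i1 \<le> i2" "j1 \<le> j2"
  shows "\<exists>P. alignment i1 i2 j1 j2 P"
  using assms
proof (induction "(i2 - i1) + (j2 - j1)" arbitrary: i1 j1)
  case 0
  then have "alignment i1 i2 j1 j2 [(i1, j1)]" by (simp add: alignment_def)
  then show ?case by blast
next
  case (Suc k)
  \<comment> \<open>The alignment goes through the rows up to \<open>i2\<close> and only then
    through the columns.\<close>
  define i j where "i = (if i1 < i2 then i1 + 1 else i1)" and "j = (if i1 < i2 then j1 else j1 + 1)"
  have "\<exists>P. alignment i i2 j j2 P"
    using Suc.hyps(2) Suc.prems by (intro Suc.hyps(1)) (auto simp: i_def j_def)
  then obtain P where "alignment i i2 j j2 P" ..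
  moreover have "alignment_step (i1, j1) (i, j)" by (auto simp: i_def j_def alignment_step_def)
  ultimately have "alignment i1 i2 j1 j2 ((i1, j1) # P)" by (auto simp: alignment_Cons)
  then show ?case by blast
qed

text \<open>The infimum belongs to the set only if the set is nonempty, which is where the nonempty
  ranges enter.\<close>

lemma DTW_attained:
  assumes "i1 \<le> i2" "j1 \<le> j2"
  obtains P where "alignment i1 i2 j1 j2 P" "DTW \<delta> A i1 i2 B j1 j2 = discrepancy \<delta> A B P"
proof -
  have "{discrepancy \<delta> A B P | P. alignment i1 i2 j1 j2 P} \<noteq> {}"
    using alignment_exists[OF assms] by blast
  from Inf_nat_def1[OF this] show thesis using that by (auto simp: DTW_def)
qed

lemma DTW_le: "alignment i1 i2 j1 j2 P \<Longrightarrow> DTW \<delta> A i1 i2 B j1 j2 \<le> discrepancy \<delta> A B P"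
  unfolding DTW_def by (rule wellorder_Inf_le1) blast

lemma DTW_step:
  assumes "alignment_step (i1, j1) (i, j)" "i \<le> i2" "j \<le> j2"
  shows "DTW \<delta> A i1 i2 B j1 j2 \<le> dissim \<delta> A B i1 j1 + DTW \<delta> A i i2 B j j2"
proof -
  obtain P where P: "alignment i i2 j j2 P" "DTW \<delta> A i i2 B j j2 = discrepancy \<delta> A B P"
    using DTW_attained[OF assms(2,3)] .
  with assms have "alignment i1 i2 j1 j2 ((i1, j1) # P)" by (auto simp: alignment_Cons)
  from DTW_le[OF this] show ?thesis by (simp add: P(2) discrepancy_def)
qed

lemma DTW_refl: "DTW \<delta> A i i B j j \<le> dissim \<delta> A B i j"
  using DTW_le[of i i j j "[(i, j)]" \<delta> A B] by (simp add: alignment_Cons discrepancy_def)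

lemma alignment_shift:
  "alignment i1 i2 (j1 + r) (j2 + r) (map (\<lambda>(i, j). (i, j + r)) P) \<longleftrightarrow> alignment i1 i2 j1 j2 P"
proof (cases "P = []")
  case False
  define f :: "nat \<times> nat \<Rightarrow> nat \<times> nat" where "f = (\<lambda>(i, j). (i, j + r))"
  have "alignment_step (f u) (f v) \<longleftrightarrow> alignment_step u v" for u v
    by (cases u; cases v) (auto simp: alignment_step_def f_def)
  moreover have "f u = (i, j + r) \<longleftrightarrow> u = (i, j)" for u i j
    by (cases u) (auto simp: f_def)
  ultimately show ?thesis
    using False unfolding f_def[symmetric]
    by (simp add: alignment_def successively_map hd_map last_map)
qed simp

lemma alignment_range:
  "\<lbrakk>alignment i1 i2 j1 j2 P; (i, j) \<in> set P\<rbrakk> \<Longrightarrow> j1 \<le> j \<and> j \<le> j2"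
proof (induction P arbitrary: i1 j1)
  case (Cons u P)
  have "j1 \<le> j2" using alignment_le[OF Cons.prems(1)] by simp
  show ?case
  proof (cases "(i, j) = u")
    case True
    then show ?thesis using Cons.prems(1) \<open>j1 \<le> j2\<close> by (simp add: alignment_Cons)
  next
    case False
    then have "(i, j) \<in> set P" using Cons.prems(2) by simp
    with Cons.prems(1) obtain a b where
      "alignment_step (i1, j1) (a, b)" "alignment a i2 b j2 P"
      by (auto simp: alignment_Cons)
    then show ?thesis using Cons.IH \<open>(i, j) \<in> set P\<close> by (fastforce simp: alignment_step_def)
  qed
qed simp

text \<open>Shifting the second index by \<open>length xs\<close> is a bijection between the
  alignments on both sides, and it preserves discrepancies because all indices stay inside
  \<open>b\<close>. It allows the pieces to be treated as index ranges of the whole series.\<close>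

lemma DTW_infix:
  "DTW \<delta> A i1 i2 (xs @ b @ ys) (length xs + 1) (length xs + length b)
     = DTW \<delta> A i1 i2 b 1 (length b)"
proof -
  let ?f = "map (\<lambda>(i, j). (i, j + length xs))"
  have disc: "discrepancy \<delta> A (xs @ b @ ys) (?f P) = discrepancy \<delta> A b P"
    if "alignment i1 i2 1 (length b) P" for P
  proof -
    have "dissim \<delta> A (xs @ b @ ys) i (j + length xs) = dissim \<delta> A b i j" if "(i, j) \<in> set P" for i j
      using alignment_range[OF \<open>alignment i1 i2 1 (length b) P\<close> that]
      by (auto simp: dissim_def nth_append)
    then show ?thesis
      unfolding discrepancy_def map_map by (intro arg_cong[of _ _ sum_list] map_cong) auto
  qed
  have "{discrepancy \<delta> A (xs @ b @ ys) P | P.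
          alignment i1 i2 (length xs + 1) (length xs + length b) P}
      = {discrepancy \<delta> A b P | P. alignment i1 i2 1 (length b) P}" (is "?L = ?R")
  proof
    show "?L \<subseteq> ?R"
    proof
      fix v assume "v \<in> ?L"
      then obtain P where v: "v = discrepancy \<delta> A (xs @ b @ ys) P"
        and P: "alignment i1 i2 (length xs + 1) (length xs + length b) P" by blast
      \<comment> \<open>The truncated subtraction is inverse to the shift since every second index
        of \<open>P\<close> exceeds \<open>length xs\<close>.\<close>
      define P' where "P' = map (\<lambda>(i, j). (i, j - length xs)) P"
      have "?f P' = P"
        using alignment_range[OF P] by (fastforce simp: P'_def o_def intro!: map_idI)
      moreover from this have "alignment i1 i2 1 (length b) P'"
        using alignment_shift[of i1 i2 1 "length xs" "length b" P'] P by (simp add: add.commute)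
      ultimately show "v \<in> ?R" using disc[of P'] v by auto
    qed
    show "?R \<subseteq> ?L"
    proof
      fix v assume "v \<in> ?R"
      then obtain P where v: "v = discrepancy \<delta> A b P" and P: "alignment i1 i2 1 (length b) P"
        by blast
      have "alignment i1 i2 (length xs + 1) (length xs + length b) (?f P)"
        using alignment_shift[of i1 i2 1 "length xs" "length b" P] P by (simp add: add.commute)
      then show "v \<in> ?L" unfolding v disc[OF P, symmetric] by blast
    qed
  qed
  then show ?thesis by (simp add: DTW_def)
qed


section \<open>Walks and candidates\<close>

context periodic_instance
begin

text \<open>The pieces of \<^term>\<open>B\<close> after position \<open>j\<close> have the lengths \<open>ls\<close>.\<close>

fun pieces_cost :: "nat \<Rightarrow> nat \<Rightarrow> nat list \<Rightarrow> nat \<Rightarrow> nat" where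
  "pieces_cost i j [] e = 0"
| "pieces_cost i j (x # ls) e =
     DTW \<delta> A i (if ls = [] then e else m) B (j + 1) (j + x) + pieces_cost 1 (j + x) ls e"

lemma pieces_cost_tail:
  assumes "Bs \<noteq> []" "[] \<notin> set Bs" "xs @ concat Bs = B"
  shows "pieces_cost 1 (length xs) (map length Bs) e =
    (\<Sum>k<length Bs - 1. DTW \<delta> A 1 m (Bs ! k) 1 (length (Bs ! k)))
      + DTW \<delta> A 1 e (last Bs) 1 (length (last Bs))"
  using assms
proof (induction Bs arbitrary: xs)
  case (Cons b bs)
  have b: "DTW \<delta> A i i' B (length xs + 1) (length xs + length b) = DTW \<delta> A i i' b 1 (length b)" for i i'
    using DTW_infix[of \<delta> A i i' xs b "concat bs"] Cons.prems by simp
  show ?case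
  proof (cases "bs = []")
    case True
    then show ?thesis using b by simp
  next
    case False
    then obtain q where q: "length bs = Suc q" by (cases bs) auto
    have "pieces_cost 1 (length (xs @ b)) (map length bs) e =
      (\<Sum>k<q. DTW \<delta> A 1 m (bs ! k) 1 (length (bs ! k)))
        + DTW \<delta> A 1 e (last bs) 1 (length (last bs))"
      using Cons.IH[of "xs @ b"] False Cons.prems q by simp
    then show ?thesis using False b q
      by (simp add: sum.lessThan_Suc_shift del: sum.lessThan_Suc)
  qed
qed simp

text \<open>The recursion makes the distinction between \<open>l = 0\<close> and
  \<open>l > 0\<close> disappear: the start row is reset to 1 after the first piece, and the end row
  is \<open>m\<close> for all pieces but the last.\<close>

lemma periodic_cost_eq_pieces_cost:
  assumes "feasible A B (l, Bs, i, i')"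
  shows "periodic_cost \<delta> A B (l, Bs, i, i') = pieces_cost i 0 (map length Bs) i'"
proof -
  from assms obtain b bs where Bs: "Bs = b # bs" "length bs = l" and ne: "[] \<notin> set Bs"
    and B: "b @ concat bs = B"
    by (cases Bs) (auto simp: feasible_def)
  have b: "DTW \<delta> A x y B 1 (length b) = DTW \<delta> A x y b 1 (length b)" for x y
    using DTW_infix[of \<delta> A x y "[]" b "concat bs"] B by simp
  show ?thesis
  proof (cases "bs = []")
    case True
    then show ?thesis using Bs B by (simp add: periodic_cost_def)
  next
    case False
    then have l: "l \<noteq> 0" using Bs by auto
    have "pieces_cost 1 (length b) (map length bs) i' =
      (\<Sum>k<l - 1. DTW \<delta> A 1 m (bs ! k) 1 (length (bs ! k)))
        + DTW \<delta> A 1 i' (last bs) 1 (length (last bs))"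
      using pieces_cost_tail[of bs b i'] False Bs ne B by simp
    moreover have "last bs = Bs ! l"
      using False Bs l by (simp add: last_conv_nth nth_Cons')
    moreover have "(\<Sum>k = 1..l - 1. DTW \<delta> A 1 m (Bs ! k) 1 (length (Bs ! k)))
      = (\<Sum>k<l - 1. DTW \<delta> A 1 m (bs ! k) 1 (length (bs ! k)))"
      by (simp add: sum.atLeast1_atMost_eq Bs(1))
    ultimately show ?thesis using b False l Bs(1) by (simp add: periodic_cost_def)
  qed
qed

section \<open>Lower bound: \<open>opt\<close> never exceeds the cost of a candidate\<close>

lemma move_alignment_step:
  assumes "alignment_step (i, j) (i', j')" "1 \<le> i" "i' \<le> m" "1 \<le> j"
  shows "\<exists>t. move (cell i j) t (cell i' j')"
proof -
  obtain x y where xy: "i = Suc x" "j = Suc y" using assms(2,4) by (cases i; cases j) auto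
  have "i \<le> i'" using assms(1) by (auto simp: alignment_step_def)
  then have "cell i j mod m = x" using assms(3) by (simp add: cell_div_mod xy)
  moreover have "cell i' j' = cell i j + 1 \<and> Suc x < m \<or> cell i' j' = cell i j + m \<or>
      cell i' j' = cell i j + m + 1 \<and> Suc x < m"
    using assms(1,3) by (auto simp: alignment_step_def cell_def xy)
  ultimately show ?thesis unfolding move_def by metis
qed

text \<open>The last cell is paid for both in the discrepancy and in
  \<open>opt (cell i2 j2)\<close>. Adding its dissimilarity on the left compensates for this without
  a subtraction on natural numbers.\<close>

lemma opt_le_alignment:
  assumes "alignment i1 i2 j1 j2 P" "1 \<le> i1" "i2 \<le> m" "1 \<le> j1" "j2 \<le> n"
  shows "opt (cell i1 j1) + dis (cell i2 j2) \<le> discrepancy \<delta> A B P + opt (cell i2 j2)"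
  using assms
proof (induction P arbitrary: i1 j1)
  case (Cons u P)
  note le = alignment_le[OF Cons.prems(1)]
  have d: "dissim \<delta> A B i1 j1 = dis (cell i1 j1)"
    using Cons.prems le by (simp add: dis_cell)
  show ?case
  proof (cases "P = []")
    case True
    then show ?thesis
      using Cons.prems(1) d by (simp add: alignment_Cons discrepancy_def)
  next
    case False
    then obtain i j where step: "alignment_step (i1, j1) (i, j)" and P: "alignment i i2 j j2 P"
      and u: "u = (i1, j1)"
      using Cons.prems(1) by (auto simp: alignment_Cons)
    note le' = alignment_le[OF P]
    have "1 \<le> i" "1 \<le> j" using step Cons.prems by (auto simp: alignment_step_def)
    have "opt (cell i1 j1) \<le> dis (cell i1 j1) + opt (cell i j)"
    proof (cases "j1 < n")
      case True
      then have "cell i1 j1 < m * n - m" using Cons.prems le by (simp add: cell_bounds)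
      moreover obtain t where "move (cell i1 j1) t (cell i j)"
        using move_alignment_step[OF step] Cons.prems le' by auto
      ultimately show ?thesis by (simp add: opt_le_move)
    next
      case False
      \<comment> \<open>The alignment may continue down the last column, but there
        \<open>opt\<close> equals the dissimilarity of the current cell, so the rest only adds to
        the right-hand side.\<close>
      then have "\<not> cell i1 j1 < m * n - m" using Cons.prems le by (simp add: cell_bounds)
      then show ?thesis by (simp add: opt_last_column)
    qed
    with Cons.IH[OF P \<open>1 \<le> i\<close> Cons.prems(3) \<open>1 \<le> j\<close> Cons.prems(5)] show ?thesis
      by (simp add: discrepancy_def u d)
  qed
qed simp

lemma opt_le_DTW:
  assumes "1 \<le> i1" "i1 \<le> i2" "i2 \<le> m" "1 \<le> j1" "j1 \<le> j2" "j2 \<le> n"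
  shows "opt (cell i1 j1) + dis (cell i2 j2) \<le> DTW \<delta> A i1 i2 B j1 j2 + opt (cell i2 j2)"
proof -
  obtain P where "alignment i1 i2 j1 j2 P" "DTW \<delta> A i1 i2 B j1 j2 = discrepancy \<delta> A B P"
    using DTW_attained[OF assms(2,5)] .
  with opt_le_alignment[of i1 i2 j1 j2 P] assms show ?thesis by simp
qed

text \<open>A piece other than the last ends in row \<open>m\<close>, from where the move with code
  2 leads to the next piece. The last piece ends in column \<open>n\<close>, where
  \<open>opt\<close> and \<open>dis\<close> agree and cancel. The last hypothesis makes the row
  range nonempty for a single piece; later pieces start in row 1 anyway.\<close>

lemma opt_le_pieces_cost:
  assumes "ls \<noteq> []" "0 \<notin> set ls" "j + sum_list ls = n" "1 \<le> i" "i \<le> m" "1 \<le> e" "e \<le> m"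
    "length ls = 1 \<Longrightarrow> i \<le> e"
  shows "opt (cell i (j + 1)) \<le> pieces_cost i j ls e"
  using assms
proof (induction ls arbitrary: i j)
  case (Cons x ls)
  have "1 \<le> x" using Cons.prems by auto
  show ?case
  proof (cases "ls = []")
    case True
    have "\<not> cell e n < m * n - m" using Cons.prems n_pos by (simp add: cell_bounds)
    then have "opt (cell e n) = dis (cell e n)" by (simp add: opt_last_column)
    with opt_le_DTW[of i e "j + 1" n] show ?thesis
      using True Cons.prems \<open>1 \<le> x\<close> by simp
  next
    case False
    have "0 \<notin> set ls" using Cons.prems by simp
    then have "0 < sum_list ls" using False by (cases ls) auto
    then have "j + x < n" using Cons.prems(3) unfolding sum_list.Cons by linarith
    have "opt (cell i (j + 1)) + dis (cell m (j + x)) \<le>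
        DTW \<delta> A i m B (j + 1) (j + x) + opt (cell m (j + x))"
      using Cons.prems \<open>1 \<le> x\<close> by (intro opt_le_DTW) auto
    moreover have "opt (cell m (j + x)) \<le> dis (cell m (j + x)) + opt (cell 1 (j + x + 1))"
    proof (rule opt_le_move)
      have m: "1 \<le> m" using m_pos by linarith
      then show "cell m (j + x) < m * n - m"
        using \<open>j + x < n\<close> \<open>1 \<le> x\<close> cell_bounds(2)[of m "j + x"] by simp
      obtain y where "j + x = Suc y" using \<open>1 \<le> x\<close> by (cases "j + x") auto
      moreover have "cell m (j + x) mod m = m - 1" using cell_div_mod(1)[of m "j + x"] m by simp
      ultimately show "move (cell m (j + x)) 2 (cell 1 (j + x + 1))"
        using m by (simp add: move_def cell_def) arith
    qed
    moreover have "opt (cell 1 (j + x + 1)) \<le> pieces_cost 1 (j + x) ls e"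
      using False \<open>0 \<notin> set ls\<close> Cons.prems m_pos by (intro Cons.IH) auto
    ultimately show ?thesis using False by simp
  qed
qed simp

text \<open>Here \<open>v\<close> is the cost of a walk from \<open>k\<close>, \<open>e\<close> its
  final row counted from 1, and \<open>ls\<close> lists the piece lengths from \<open>k\<close> on.
  The head of \<open>ls\<close> counts the columns of the current piece beginning with that of
  \<open>k\<close>, hence the \<open>1\<close> in \<open>finish\<close> and
  \<open>wrap\<close>.\<close>

inductive walk :: "nat \<Rightarrow> nat list \<Rightarrow> nat \<Rightarrow> nat \<Rightarrow> bool" where
  finish: "m * n - m \<le> k \<Longrightarrow> k < m * n \<Longrightarrow> walk k [1] (k mod m + 1) (dis k)"
| down: "move k 0 k' \<Longrightarrow> walk k' ls e v \<Longrightarrow> walk k ls e (dis k + v)"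
| along: "move k 1 k' \<Longrightarrow> walk k' (x # ls) e v \<Longrightarrow> walk k (Suc x # ls) e (dis k + v)"
| wrap: "move k 2 k' \<Longrightarrow> walk k' ls e v \<Longrightarrow> walk k (1 # ls) e (dis k + v)"

lemma last_column:
  assumes "m * n - m \<le> k" "k < m * n"
  shows "k div m = n - 1" "k mod m = k - (m * n - m)"
proof -
  define r where "r = k - (m * n - m)"
  have "m * n - m = (n - 1) * m" by (simp add: diff_mult_distrib mult.commute[of m])
  then have k: "k = (n - 1) * m + r" using assms(1) by (simp add: r_def)
  have "r < m" using assms by (simp add: r_def)
  then show "k div m = n - 1" "k mod m = k - (m * n - m)"
    using A_nonempty k unfolding r_def[symmetric] by simp_all
qed

text \<open>The cost is only bounded, since a walk follows some alignment of each piece, not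
  necessarily an optimal one. Rows never decrease within a piece; the conjunct for a single piece
  records this, as feasibility requires it for \<open>l = 0\<close>.\<close>

lemma walk_pieces:
  assumes "walk k ls e v"
  shows "ls \<noteq> [] \<and> 0 \<notin> set ls \<and> k div m + sum_list ls = n \<and> 1 \<le> e \<and> e \<le> m \<and>
    (length ls = 1 \<longrightarrow> Suc (k mod m) \<le> e) \<and> pieces_cost (Suc (k mod m)) (k div m) ls e \<le> v"
  using assms
proof (induction rule: walk.induct)
  case (finish k)
  have "k mod m < m" by (rule mod_less_divisor) (rule m_pos)
  then show ?case using n_pos DTW_refl[of \<delta> A "Suc (k mod m)" B n]
    by (auto simp: last_column[OF finish] dis_def)
next
  case (down k k' ls e v)
  then obtain x xs where ls: "ls = x # xs" by (cases ls) auto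
  have k': "Suc (k mod m) < m" "k' mod m = Suc (k mod m)" "k' div m = k div m"
    using down.hyps(1) by (auto simp: move_def mod_Suc div_Suc)
  have "DTW \<delta> A (Suc (k mod m)) (if xs = [] then e else m) B (k div m + 1) (k div m + x)
      \<le> dis k + DTW \<delta> A (Suc (k' mod m)) (if xs = [] then e else m) B (k div m + 1) (k div m + x)"
    using DTW_step[of "Suc (k mod m)" "k div m + 1" "Suc (k' mod m)" "k div m + 1"
        "if xs = [] then e else m" "k div m + x" \<delta> A B] down.IH k' ls
    by (auto simp: alignment_step_def dis_def)
  then show ?case using down.IH k' ls by auto
next
  case (along k k' x ls e v)
  have "k' mod m = k mod m \<or> Suc (k mod m) < m \<and> k' mod m = Suc (k mod m)" "k' div m = Suc (k div m)"
    using along.hyps(1) A_nonempty by (auto simp: move_def mod_Suc div_Suc)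
  note k' = this
  have "DTW \<delta> A (Suc (k mod m)) (if ls = [] then e else m) B (k div m + 1) (k div m + Suc x)
      \<le> dis k + DTW \<delta> A (Suc (k' mod m)) (if ls = [] then e else m) B (k div m + 2) (k div m + Suc x)"
    using DTW_step[of "Suc (k mod m)" "k div m + 1" "Suc (k' mod m)" "k div m + 2"
        "if ls = [] then e else m" "k div m + Suc x" \<delta> A B] along.IH k'
      mod_less_divisor[OF m_pos, of k]
    by (auto simp: alignment_step_def dis_def)
  then show ?case using along.IH k' by auto
next
  case (wrap k k' ls e v)
  have k': "Suc (k mod m) = m" "k' mod m = 0" "k' div m = Suc (k div m)"
    using wrap.hyps(1) by (auto simp: move_def mod_Suc div_Suc)
  then show ?case using wrap.IH DTW_refl[of \<delta> A m B "Suc (k div m)"]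
    by (auto simp: dis_def)
qed

lemma list_with_lengths: "sum_list ls = length xs \<Longrightarrow> \<exists>xss. map length xss = ls \<and> concat xss = xs"
proof (induction ls arbitrary: xs)
  case (Cons l ls)
  from Cons.prems have "sum_list ls = length (drop l xs)" by simp
  from Cons.IH[OF this]
  obtain xss where "map length xss = ls" "concat xss = drop l xs" by blast
  with Cons.prems have "map length (take l xs # xss) = l # ls \<and> concat (take l xs # xss) = xs"
    by simp
  then show ?case by (rule exI)
qed simp

text \<open>Optimality is the chain: cost of \<open>q\<close> \<le> \<open>opt k\<close> \<le>
  \<open>opt (i - 1)\<close> \<le> cost of \<open>q'\<close>, where \<open>i - 1\<close> is the
  number of the first cell of the competitor \<open>q'\<close>.\<close>

lemma solution_of_walk:
  assumes k: "k < m" and min: "\<And>k'. k' < m \<Longrightarrow> opt k \<le> opt k'" and walk: "walk k ls e (opt k)"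
  obtains q where "output_words q = (length ls - 1) # (k + 1) # e # ls"
    "periodic_DTW_solution \<delta> A B q"
proof -
  from walk_pieces[OF walk] k
  have ls: "ls \<noteq> []" "0 \<notin> set ls" "sum_list ls = n" "1 \<le> e" "e \<le> m" "length ls = 1 \<Longrightarrow> Suc k \<le> e"
    and cost: "pieces_cost (Suc k) 0 ls e \<le> opt k"
    by auto
  obtain Bs where Bs: "map length Bs = ls" "concat Bs = B"
    using list_with_lengths ls(3) by blast
  define q where "q = (length ls - 1, Bs, k + 1, e)"
  have feas: "feasible A B q"
    using ls Bs k by (cases ls) (auto simp: q_def feasible_def)
  have "periodic_cost \<delta> A B q \<le> periodic_cost \<delta> A B q'" if q': "feasible A B q'" for q'
  proof -
    obtain l Bs' i i' where q'_eq: "q' = (l, Bs', i, i')" by (cases q')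
    have len: "sum_list (map length Bs') = n"
      using q' length_concat[of Bs'] by (simp add: q'_eq feasible_def)
    have "opt (cell i (0 + 1)) \<le> pieces_cost i 0 (map length Bs') i'"
      using q' len by (intro opt_le_pieces_cost) (auto simp: q'_eq feasible_def)
    also have "\<dots> = periodic_cost \<delta> A B q'"
      using q' by (simp add: q'_eq periodic_cost_eq_pieces_cost)
    finally have *: "opt (i - 1) \<le> periodic_cost \<delta> A B q'"
      by (simp add: cell_def)
    have "periodic_cost \<delta> A B q \<le> opt k"
      using feas cost Bs by (simp add: q_def periodic_cost_eq_pieces_cost)
    also have "\<dots> \<le> opt (i - 1)"
      using q' by (intro min) (auto simp: q'_eq feasible_def)
    finally show ?thesis using * by simp
  qed
  with feas have "periodic_DTW_solution \<delta> A B q" by (simp add: periodic_DTW_solution_def)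
  then show thesis using that[of q] Bs by (simp add: q_def output_words_def)
qed

end


section \<open>Reasoning about runs\<close>

text \<open>A weakest precondition for total correctness that also sees the running time.
  Determinism turns the rules for single instructions into equations, so straight-line code can be
  evaluated by rewriting.\<close>

definition run :: "nat \<Rightarrow> nat \<Rightarrow> prog \<Rightarrow> state \<Rightarrow> (nat \<Rightarrow> state \<Rightarrow> bool) \<Rightarrow> bool" where
  "run w S p s Q \<longleftrightarrow> (\<exists>t s'. exec w S p s t s' \<and> Q t s')"

lemma run_mono: "run w S p s P \<Longrightarrow> (\<And>t s'. P t s' \<Longrightarrow> Q t s') \<Longrightarrow> run w S p s Q"
  unfolding run_def by blast

lemma run_exec: "exec w S p s t s' \<Longrightarrow> run w S p s Q \<longleftrightarrow> Q t s'"
  unfolding run_def using exec_deterministic by blast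

lemma run_Skip [simp]: "run w S Skip s Q \<longleftrightarrow> Q 1 s"
  by (rule run_exec[OF exec.Skip])

lemma run_Const [simp]: "run w S (Const r k) (R, M) Q \<longleftrightarrow> k < 2 ^ w \<and> Q 1 (R(r := k), M)"
proof (cases "k < 2 ^ w")
  case True
  then show ?thesis using run_exec[OF exec.Const] by simp
qed (auto simp: run_def elim: exec_ConstE)

lemma run_Op [simp]:
  "run w S (Op f r x y) (R, M) Q \<longleftrightarrow>
     apply_binop f (R x) (R y) < 2 ^ w \<and> Q 1 (R(r := apply_binop f (R x) (R y)), M)"
proof (cases "apply_binop f (R x) (R y) < 2 ^ w")
  case True
  then show ?thesis using run_exec[OF exec.Op[of f R x y w S r M]] by simp
qed (auto simp: run_def elim: exec_OpE)

lemma run_Load [simp]: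
  "run w S (Load r a) (R, M) Q \<longleftrightarrow> R a < S \<and> M (R a) < 2 ^ w \<and> Q 1 (R(r := M (R a)), M)"
proof (cases "R a < S \<and> M (R a) < 2 ^ w")
  case True
  then show ?thesis using run_exec[OF exec.Load[of R a S M w r]] by simp
qed (auto simp: run_def elim: exec_LoadE)

lemma run_Store [simp]:
  "run w S (Store a r) (R, M) Q \<longleftrightarrow> R a < S \<and> Q 1 (R, M(R a := R r))"
proof (cases "R a < S")
  case True
  then show ?thesis using run_exec[OF exec.Store[of R a S w r M]] by simp
qed (auto simp: run_def elim: exec_StoreE)

lemma run_Seq:
  "run w S (Seq p q) s Q \<longleftrightarrow> run w S p s (\<lambda>t s'. run w S q s' (\<lambda>t'. Q (t + t')))"
proof
  assume "run w S (Seq p q) s Q"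
  then show "run w S p s (\<lambda>t s'. run w S q s' (\<lambda>t'. Q (t + t')))"
    unfolding run_def by (blast elim: exec_SeqE)
next
  assume "run w S p s (\<lambda>t s'. run w S q s' (\<lambda>t'. Q (t + t')))"
  then show "run w S (Seq p q) s Q" unfolding run_def by (blast intro: exec.Seq)
qed

lemma run_IfLess [simp]:
  "run w S (IfLess x y p q) (R, M) Q \<longleftrightarrow>
     (if R x < R y then run w S p (R, M) (\<lambda>t. Q (1 + t)) else run w S q (R, M) (\<lambda>t. Q (1 + t)))"
proof -
  have "exec w S (IfLess x y p q) (R, M) t s \<longleftrightarrow>
      (\<exists>t'. t = 1 + t' \<and> exec w S (if R x < R y then p else q) (R, M) t' s)" for t s
    using exec.IfTrue[of "(R, M)" x y w S p _ s q] exec.IfFalse[of "(R, M)" x y w S q _ s p]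
    by (auto elim!: exec_IfE)
  then show ?thesis unfolding run_def by auto
qed

text \<open>The measure \<open>\<mu>\<close> bounds the number of iterations. Each costs at most
  \<open>b\<close> for the body and 1 for its test, and the failing test accounts for the final
  1.\<close>

lemma run_WhileLess:
  assumes step: "\<And>R M. I (R, M) \<Longrightarrow> R x < R y \<Longrightarrow>
      run w S p (R, M) (\<lambda>t s'. t \<le> b \<and> I s' \<and> \<mu> s' < \<mu> (R, M))"
    and "I s"
    and final: "\<And>t s'. I s' \<Longrightarrow> \<not> fst s' x < fst s' y \<Longrightarrow> t \<le> 1 + (b + 1) * \<mu> s \<Longrightarrow> Q t s'"
  shows "run w S (WhileLess x y p) s Q"
proof -
  have "\<exists>t s'. exec w S (WhileLess x y p) s t s' \<and> I s' \<and> \<not> fst s' x < fst s' y \<and>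
      t \<le> 1 + (b + 1) * \<mu> s"
    using \<open>I s\<close>
  proof (induction "\<mu> s" arbitrary: s rule: less_induct)
    case less
    obtain R M where s: "s = (R, M)" by (cases s)
    show ?case
    proof (cases "R x < R y")
      case True
      from step[OF less.prems[unfolded s] True] obtain t s' where
        t: "exec w S p s t s'" "t \<le> b" and s': "I s'" "\<mu> s' < \<mu> s"
        unfolding run_def s by blast
      from less.hyps[OF s'(2,1)] obtain t' s'' where
        t': "exec w S (WhileLess x y p) s' t' s''" "t' \<le> 1 + (b + 1) * \<mu> s'"
        and s'': "I s''" "\<not> fst s'' x < fst s'' y"
        by blast
      have "exec w S (WhileLess x y p) s (1 + t + t') s''"
        using True t(1) t'(1) by (intro exec.WhileTrue) (simp_all add: s)
      moreover have "(b + 1) * Suc (\<mu> s') \<le> (b + 1) * \<mu> s"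
        using s'(2) by (intro mult_le_mono2) simp
      then have "1 + t + t' \<le> 1 + (b + 1) * \<mu> s" using t(2) t'(2) by simp
      ultimately show ?thesis using s'' by blast
    next
      case False
      then have "exec w S (WhileLess x y p) s 1 s" by (intro exec.WhileFalse) (simp add: s)
      then show ?thesis using False less.prems s by fastforce
    qed
  qed
  then show ?thesis using final unfolding run_def by blast
qed

fun block :: "prog list \<Rightarrow> prog" where
  "block [] = Skip"
| "block (p # ps) = Seq p (block ps)"

lemma run_block_Cons [simp]:
  "run w S (block (p # ps)) s Q \<longleftrightarrow> run w S p s (\<lambda>t s'. run w S (block ps) s' (\<lambda>t'. Q (t + t')))"
  by (simp add: run_Seq)

declare block.simps(2) [simp del]


section \<open>The program\<close>

abbreviation (input) "r_zero \<equiv> 2 :: nat"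
abbreviation (input) "r_one \<equiv> 3 :: nat"
abbreviation (input) "r_two \<equiv> 4 :: nat"
abbreviation (input) "r_three \<equiv> 5 :: nat"
abbreviation (input) "r_m \<equiv> 6 :: nat"
abbreviation (input) "r_n \<equiv> 7 :: nat"
abbreviation (input) "r_cells \<equiv> 8 :: nat"
abbreviation (input) "r_last \<equiv> 9 :: nat"  \<comment> \<open>the first cell of the last column\<close>
abbreviation (input) "r_base \<equiv> 10 :: nat"  \<comment> \<open>the address of the table of optimal costs\<close>
abbreviation (input) "r_k \<equiv> 11 :: nat"
abbreviation (input) "r_val \<equiv> 12 :: nat"
abbreviation (input) "r_next \<equiv> 13 :: nat"
abbreviation (input) "r_kind \<equiv> 14 :: nat"
abbreviation (input) "r_a \<equiv> 15 :: nat"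
abbreviation (input) "r_b \<equiv> 16 :: nat"
abbreviation (input) "r_c \<equiv> 17 :: nat"
abbreviation (input) "r_start \<equiv> 18 :: nat"
abbreviation (input) "r_pieces \<equiv> 19 :: nat"  \<comment> \<open>the number of completed pieces\<close>
abbreviation (input) "r_len \<equiv> 20 :: nat"  \<comment> \<open>the length of the current piece, minus one\<close>

definition setup_prog :: prog where
  "setup_prog = block
    [Const r_one 1, Const r_two 2, Const r_three 3, Load r_m r_zero, Load r_n r_one,
     Op Times r_cells r_m r_n, Op Minus r_last r_cells r_m,
     Op Plus r_base r_cells r_n, Op Plus r_base r_base r_three, Op Plus r_k r_cells r_zero]"

text \<open>Shared by filling and tracing. It leaves \<open>dis k\<close> out of
  \<open>r_val\<close>, so it reads only the table. After the row computation, \<open>r_b\<close>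
  holds \<open>k mod m + 1\<close>, which decides between moving down and wrapping and whether a
  diagonal move exists.\<close>

definition best_move_prog :: prog where
  "best_move_prog = IfLess r_k r_last
    (block
      [Op Plus r_a r_base r_k, Op Plus r_a r_a r_one, Load r_val r_a, Op Plus r_next r_k r_one,
       Op Divide r_b r_k r_m, Op Times r_b r_b r_m, Op Minus r_b r_k r_b, Op Plus r_b r_b r_one,
       IfLess r_b r_m (Const r_kind 0) (Const r_kind 2),
       Op Plus r_a r_base r_k, Op Plus r_a r_a r_m, Load r_c r_a,
       IfLess r_c r_val
         (block [Op Plus r_val r_c r_zero, Op Plus r_next r_k r_m, Const r_kind 1]) Skip,
       IfLess r_b r_m
         (block [Op Plus r_a r_a r_one, Load r_c r_a,
            IfLess r_c r_val
              (block [Op Plus r_val r_c r_zero, Op Plus r_next r_k r_m,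
                 Op Plus r_next r_next r_one, Const r_kind 1]) Skip])
         Skip])
    (Const r_val 0)"

definition fill_prog :: prog where
  "fill_prog = WhileLess r_zero r_k (block
    [Op Minus r_k r_k r_one, best_move_prog,
     Op Divide r_a r_k r_m, Op Times r_b r_a r_m, Op Minus r_b r_k r_b, Op Times r_b r_b r_n,
     Op Plus r_a r_a r_b, Op Plus r_a r_a r_two, Load r_a r_a, Op Plus r_val r_val r_a,
     Op Plus r_a r_base r_k, Store r_a r_val])"

definition start_prog :: prog where
  "start_prog = block
    [Op Plus r_start r_zero r_zero, Op Plus r_k r_zero r_zero,
     WhileLess r_k r_m (block
       [Op Plus r_a r_base r_k, Load r_a r_a, Op Plus r_b r_base r_start, Load r_b r_b,
        IfLess r_a r_b (Op Plus r_start r_k r_zero) Skip, Op Plus r_k r_k r_one])]"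

text \<open>Lengths of completed pieces are written from address 3 on, over the dissimilarities. The
  three words before them are filled in last, as the number of pieces and the end row are known only
  then.\<close>

definition trace_prog :: prog where
  "trace_prog = block
    [Op Plus r_k r_start r_zero, Op Plus r_pieces r_zero r_zero, Op Plus r_len r_zero r_zero,
     WhileLess r_k r_last (block
       [best_move_prog,
        IfLess r_kind r_one Skip
          (IfLess r_kind r_two (Op Plus r_len r_len r_one)
            (block [Op Plus r_a r_pieces r_three, Op Plus r_len r_len r_one, Store r_a r_len,
               Op Plus r_pieces r_pieces r_one, Op Plus r_len r_zero r_zero])),
        Op Plus r_k r_next r_zero])]"

definition output_prog :: prog where
  "output_prog = block
    [Op Plus r_a r_pieces r_three, Op Plus r_len r_len r_one, Store r_a r_len,
     Store r_zero r_pieces, Op Plus r_start r_start r_one, Store r_one r_start,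
     Op Minus r_k r_k r_last, Op Plus r_k r_k r_one, Store r_two r_k]"

definition periodic_DTW_prog :: prog where
  "periodic_DTW_prog = block [setup_prog, fill_prog, start_prog, trace_prog, output_prog]"

section \<open>Memory layout and word size\<close>

locale machine_instance = periodic_instance +
  fixes w :: nat
  assumes word: "c * n + 6 * (m * n) < 2 ^ w"
begin

text \<open>The table ends at \<open>base + m * n\<close>, that is
  \<open>2 * (m * n) + n + 3\<close>, which is at most \<open>(2 + 1 + 3) * (m * n)\<close>. The
  word assumption covers the costs, at most \<open>c * n\<close>, and all addresses and
  counters.\<close>

abbreviation "S \<equiv> 6 * (m * n)"

text \<open>Below \<open>base\<close> there is room for the \<open>m * n + 2\<close> words of the
  input and also for the at most \<open>n + 3\<close> words of the output.\<close>

definition base :: nat where "base = m * n + n + 3"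

definition frame :: "(nat \<Rightarrow> nat) \<Rightarrow> bool" where
  "frame R \<longleftrightarrow> R r_zero = 0 \<and> R r_one = 1 \<and> R r_two = 2 \<and> R r_three = 3 \<and> R r_m = m \<and> R r_n = n \<and>
     R r_cells = m * n \<and> R r_last = m * n - m \<and> R r_base = base"

definition table :: "nat \<Rightarrow> (nat \<Rightarrow> nat) \<Rightarrow> bool" where
  "table l M \<longleftrightarrow> (\<forall>k. l \<le> k \<and> k < m * n \<longrightarrow> M (base + k) = opt k)"

text \<open>The matrix is stored row by row behind two header words, whereas cells are numbered
  column by column; the address formula translates between the two orders.\<close>

definition input :: "(nat \<Rightarrow> nat) \<Rightarrow> bool" where
  "input M \<longleftrightarrow> (\<forall>k < m * n. M (k div m + k mod m * n + 2) = dis k)"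

lemma n_le: "n \<le> m * n" and m_le: "m \<le> m * n" and cells_pos: "1 \<le> m * n"
  using m_pos n_pos by (auto simp: Suc_le_eq)

lemma opt_word: "k < m * n \<Longrightarrow> opt k < 2 ^ w"
  using opt_le[of k] word by linarith

text \<open>Moves increase the cell number, so only table entries after \<open>k\<close> have to be
  correct. The same specification therefore serves during filling, when entry \<open>k\<close> is
  still missing, and during tracing.\<close>

lemma best_move_run:
  assumes R: "frame R" "R r_k = k" and k: "k < m * n" and M: "table (k + 1) M"
  shows "run w S best_move_prog (R, M) (\<lambda>t (R', M'). t \<le> 40 \<and> M' = M \<and>
    (\<forall>r. r \<notin> {r_val, r_next, r_kind, r_a, r_b, r_c} \<longrightarrow> R' r = R r) \<and>
    opt k = dis k + R' r_val \<and>
    (k < m * n - m \<longrightarrow> move k (R' r_kind) (R' r_next) \<and> opt (R' r_next) = R' r_val))"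
proof (cases "k < m * n - m")
  case True
  have c: "Suc (k mod m) < m \<Longrightarrow> Suc (k + m) < m * n"
    using Suc_less_of_not_last_row[OF True] .
  have k': "Suc k < m * n" "k + m < m * n" using True m_pos by linarith+
  have b: "base + m * n \<le> S" using n_le cells_pos unfolding base_def by linarith
  have km: "k div m * m \<le> k" "k div m \<le> k" "k mod m \<le> k" by simp_all
  have w: "2 < (2::nat) ^ w" "k div m < 2 ^ w" "k div m * m < 2 ^ w" "k mod m < 2 ^ w"
    "Suc (k mod m) < 2 ^ w" "Suc k < 2 ^ w" "k + m < 2 ^ w" "base + k < 2 ^ w"
    "Suc (base + k) < 2 ^ w" "base + k + m < 2 ^ w" "Suc (base + k) < S" "base + k + m < S"
    using word b k' km m_pos cells_pos by linarith+
  \<comment> \<open>The diagonal entry is read only outside the last row; from the last row its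
    address could lie just past the table.\<close>
  have wc: "Suc (base + k + m) < 2 ^ w" "Suc (base + k + m) < S" "Suc (k + m) < 2 ^ w"
    if "Suc (k mod m) < m"
    using word b c[OF that] by linarith+
  have t: "M (base + x) = opt x" if "k < x" "x < m * n" for x
    using M that unfolding table_def by simp
  have v: "M (Suc (base + k)) = opt (Suc k)" "M (base + k + m) = opt (k + m)"
    "Suc (k mod m) < m \<Longrightarrow> M (Suc (base + k + m)) = opt (Suc (k + m))"
    using t[of "Suc k"] t[of "k + m"] t[of "Suc (k + m)"] k' c m_pos by (auto simp: add.assoc)
  have ov: "opt (Suc k) < 2 ^ w" "opt (k + m) < 2 ^ w"
    "Suc (k mod m) < m \<Longrightarrow> opt (Suc (k + m)) < 2 ^ w"
    using opt_word k' c by auto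
  have opt_k: "opt k = dis k + min (min (opt (Suc k)) (opt (k + m)))
      (if Suc (k mod m) < m then opt (Suc (k + m)) else opt (k + m))"
    using True by (subst opt.simps) simp
  have move_k: "move k (Suc 0) (k + m)" "Suc (k mod m) < m \<Longrightarrow> move k 0 (Suc k)"
    "Suc (k mod m) < m \<Longrightarrow> move k (Suc 0) (Suc (k + m))" "\<not> Suc (k mod m) < m \<Longrightarrow> move k 2 (Suc k)"
    using mod_less_divisor[OF m_pos, of k] by (auto simp: move_def)
  show ?thesis
    using R True w wc v ov move_k
    by (auto simp: best_move_prog_def frame_def minus_div_mult_eq_mod opt_k)
next
  case False
  then show ?thesis using R
    by (simp add: best_move_prog_def frame_def opt_last_column)
qed

lemma input_address: "k < m * n \<Longrightarrow> k div m + k mod m * n + 2 < base"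
proof -
  assume k: "k < m * n"
  have "k div m < n" using k by (simp add: less_mult_imp_div_less mult.commute)
  moreover have "k mod m * n + n \<le> m * n"
    using mod_less_divisor[OF m_pos, of k] mult_le_mono1[of "Suc (k mod m)" m n] by simp
  ultimately show ?thesis by (simp add: base_def)
qed

text \<open>Every address holding a dissimilarity is below \<open>base\<close>, so storing costs
  during the sweep leaves the input intact.\<close>

lemma input_upd: "input M \<Longrightarrow> input (M(base + k := v))"
  using input_address by (force simp: input_def)

lemma table_upd: "table (Suc k) M \<Longrightarrow> table k (M(base + k := opt k))"
  by (auto simp: table_def Suc_le_eq le_neq_implies_less)

lemma table_upd_below: "a < base \<Longrightarrow> table k M \<Longrightarrow> table k (M(a := v))"
  by (auto simp: table_def)

section \<open>The phases of the program\<close>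

lemma setup_run:
  "run w S setup_prog (initial_state (input_words \<delta> A B))
     (\<lambda>t (R, M). t \<le> 20 \<and> frame R \<and> R r_k = m * n \<and> input M)"
proof -
  let ?xs = "input_words \<delta> A B"
  have len: "length ?xs = m * n + 2"
    by (simp add: input_words_def length_concat o_def sum_list_triv)
  have row: "concat (map (\<lambda>a. map (\<delta> a) B) xs) ! (j + i * n) = \<delta> (xs ! i) (B ! j)"
    if "i < length xs" "j < n" for xs i j
    using that
  proof (induction xs arbitrary: i)
    case (Cons x xs)
    then show ?case by (cases i) (auto simp: nth_append algebra_simps)
  qed simp
  have M: "input (\<lambda>a. if a < length ?xs then ?xs ! a else 0)"
    unfolding input_def
  proof (intro allI impI)
    fix k assume k: "k < m * n"
    have km: "k div m < n" "k mod m < m"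
      using k mod_less_divisor[OF m_pos, of k]
      by (simp_all add: less_mult_imp_div_less mult.commute)
    have "k mod m * n + n \<le> m * n"
      using km(2) mult_le_mono1[of "Suc (k mod m)" m n] by simp
    then have "k div m + k mod m * n < m * n" using km(1) by linarith
    then show "(if k div m + k mod m * n + 2 < length ?xs then ?xs ! (k div m + k mod m * n + 2) else 0)
        = dis k"
      using row[OF km(2,1)] by (simp add: len) (simp add: input_words_def dis_def dissim_def)
  qed
  have "?xs ! 0 = m" "?xs ! Suc 0 = n" by (simp_all add: input_words_def)
  moreover have "3 < (2::nat) ^ w" "m < 2 ^ w" "n < 2 ^ w" "m * n < 2 ^ w" "m * n - m < 2 ^ w"
    "m * n + n < 2 ^ w" "m * n + n + 3 < 2 ^ w" "2 < (2::nat) ^ w" "Suc 0 < (2::nat) ^ w"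
    "Suc 0 < S" "0 < S"
    using word cells_pos m_le n_le by linarith+
  ultimately show ?thesis using M len
    by (simp add: setup_prog_def initial_state_def frame_def base_def)
qed

lemma fill_run:
  assumes "frame R" "R r_k = m * n" "input M"
  shows "run w S fill_prog (R, M)
    (\<lambda>t (R', M'). t \<le> 1 + 61 * (m * n) \<and> frame R' \<and> table 0 M')"
  unfolding fill_prog_def
proof (rule run_WhileLess[where b = 60 and \<mu> = "\<lambda>s. fst s r_k"
      and I = "\<lambda>(R, M). frame R \<and> R r_k \<le> m * n \<and> table (R r_k) M \<and> input M"])
  show "case (R, M) of (R, M) \<Rightarrow> frame R \<and> R r_k \<le> m * n \<and> table (R r_k) M \<and> input M"
    using assms by (simp add: table_def)
next
  fix t s'
  assume "case s' of (R, M) \<Rightarrow> frame R \<and> R r_k \<le> m * n \<and> table (R r_k) M \<and> input M"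
    and "\<not> fst s' r_zero < fst s' r_k" and "t \<le> 1 + (60 + 1) * fst (R, M) r_k"
  then show "case s' of (R', M') \<Rightarrow> t \<le> 1 + 61 * (m * n) \<and> frame R' \<and> table 0 M'"
    using assms(2) by (cases s') (auto simp: frame_def)
next
  fix R M
  assume "case (R, M) of (R, M) \<Rightarrow> frame R \<and> R r_k \<le> m * n \<and> table (R r_k) M \<and> input M"
    and "R r_zero < R r_k"
  then obtain k where k: "R r_k = Suc k" "k < m * n" and R: "frame R" and M: "table (Suc k) M" "input M"
    by (cases "R r_k") auto
  have best: "run w S best_move_prog (R(r_k := k), M) (\<lambda>t (R', M'). t \<le> 40 \<and> M' = M \<and>
    (\<forall>r. r \<notin> {r_val, r_next, r_kind, r_a, r_b, r_c} \<longrightarrow> R' r = (R(r_k := k)) r) \<and>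
    opt k = dis k + R' r_val \<and>
    (k < m * n - m \<longrightarrow> move k (R' r_kind) (R' r_next) \<and> opt (R' r_next) = R' r_val))"
    by (rule best_move_run) (use R M k in \<open>simp_all add: frame_def\<close>)
  have a: "k div m + k mod m * n + 2 < base" using input_address[OF k(2)] .
  have b: "base + m * n \<le> S" using n_le cells_pos unfolding base_def by linarith
  have km: "k div m * m \<le> k" "k mod m \<le> k" by simp_all
  have w: "k < 2 ^ w" "k div m < 2 ^ w" "k div m * m < 2 ^ w" "k mod m < 2 ^ w"
    "k mod m * n < 2 ^ w" "k div m + k mod m * n < 2 ^ w" "k div m + k mod m * n + 2 < 2 ^ w"
    "base + k < 2 ^ w" "base + k < S" "k div m + k mod m * n + 2 < S"
    using word b a k(2) km by linarith+
  have d: "M (k div m + k mod m * n + 2) = dis k" using M(2) k(2) by (simp add: input_def)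
  \<comment> \<open>By its recursion \<open>opt k\<close> is at least \<open>dis k\<close>, so the
    dissimilarity inherits the word bound of the table entry.\<close>
  have dw: "dis k < 2 ^ w" "opt k < 2 ^ w"
    using opt_word[OF k(2)] opt.simps[of k] by (auto split: if_splits)
  show "run w S (block
    [Op Minus r_k r_k r_one, best_move_prog,
     Op Divide r_a r_k r_m, Op Times r_b r_a r_m, Op Minus r_b r_k r_b, Op Times r_b r_b r_n,
     Op Plus r_a r_a r_b, Op Plus r_a r_a r_two, Load r_a r_a, Op Plus r_val r_val r_a,
     Op Plus r_a r_base r_k, Store r_a r_val]) (R, M)
    (\<lambda>t s'. t \<le> 60 \<and>
      (case s' of (R, M) \<Rightarrow> frame R \<and> R r_k \<le> m * n \<and> table (R r_k) M \<and> input M) \<and>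
      fst s' r_k < fst (R, M) r_k)"
    unfolding run_block_Cons[of w S "Op Minus r_k r_k r_one"]
      run_block_Cons[of w S best_move_prog] run_Op
  proof (intro conjI)
    have eq: "apply_binop Minus (R r_k) (R r_one) = k" using R k by (simp add: frame_def)
    show "apply_binop Minus (R r_k) (R r_one) < 2 ^ w" unfolding eq by (rule w)
    show "run w S best_move_prog (R(r_k := apply_binop Minus (R r_k) (R r_one)), M)
      (\<lambda>t s'. run w S (block
        [Op Divide r_a r_k r_m, Op Times r_b r_a r_m, Op Minus r_b r_k r_b, Op Times r_b r_b r_n,
         Op Plus r_a r_a r_b, Op Plus r_a r_a r_two, Load r_a r_a, Op Plus r_val r_val r_a,
         Op Plus r_a r_base r_k, Store r_a r_val]) s'
        (\<lambda>t' s'. 1 + (t + t') \<le> 60 \<and>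
          (case s' of (R, M) \<Rightarrow> frame R \<and> R r_k \<le> m * n \<and> table (R r_k) M \<and> input M) \<and>
          fst s' r_k < fst (R, M) r_k))"
      unfolding eq
    proof (rule run_mono[OF best], clarify)
      fix t :: nat and R'
      assume t: "t \<le> 40" and R': "\<forall>r. r \<notin> {r_val, r_next, r_kind, r_a, r_b, r_c} \<longrightarrow>
          R' r = (R(r_k := k)) r"
        and o: "opt k = dis k + R' r_val"
      then have "R' r_val + dis k = opt k" by simp
      moreover have "frame R'" "R' r_k = k" using R R' by (simp_all add: frame_def)
      ultimately show "run w S (block
        [Op Divide r_a r_k r_m, Op Times r_b r_a r_m, Op Minus r_b r_k r_b, Op Times r_b r_b r_n,
         Op Plus r_a r_a r_b, Op Plus r_a r_a r_two, Load r_a r_a, Op Plus r_val r_val r_a,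
         Op Plus r_a r_base r_k, Store r_a r_val]) (R', M)
        (\<lambda>t' s'. 1 + (t + t') \<le> 60 \<and>
          (case s' of (R, M) \<Rightarrow> frame R \<and> R r_k \<le> m * n \<and> table (R r_k) M \<and> input M) \<and>
          fst s' r_k < fst (R, M) r_k)"
        using t w d dw k M table_upd[of k M] input_upd[of M k]
        by (simp add: frame_def minus_div_mult_eq_mod)
    qed
  qed
qed

text \<open>The cells below \<open>m\<close> form the first column, and a walk may start in any of
  its rows.\<close>

lemma start_run:
  assumes "frame R" "table 0 M"
  shows "run w S start_prog (R, M) (\<lambda>t (R', M'). t \<le> 10 + 21 * m \<and> M' = M \<and> frame R' \<and>
    R' r_start < m \<and> (\<forall>k < m. opt (R' r_start) \<le> opt k))"
proof -
  define R0 where "R0 = R(r_start := 0, r_k := 0)"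
  define p where "p = block [Op Plus r_a r_base r_k, Load r_a r_a, Op Plus r_b r_base r_start,
    Load r_b r_b, IfLess r_a r_b (Op Plus r_start r_k r_zero) Skip, Op Plus r_k r_k r_one]"
  have loop: "run w S (WhileLess r_k r_m p) (R0, M) (\<lambda>t (R', M'). t \<le> 1 + 21 * m \<and> M' = M \<and>
    frame R' \<and> R' r_start < m \<and> (\<forall>k < m. opt (R' r_start) \<le> opt k))"
  proof (rule run_WhileLess[where b = 20 and \<mu> = "\<lambda>s. m - fst s r_k"
        and I = "\<lambda>(R, M'). M' = M \<and> frame R \<and> R r_start < m \<and> R r_k \<le> m \<and>
          (\<forall>k < R r_k. opt (R r_start) \<le> opt k)"])
    show "case (R0, M) of (R, M') \<Rightarrow> M' = M \<and> frame R \<and> R r_start < m \<and> R r_k \<le> m \<and>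
          (\<forall>k < R r_k. opt (R r_start) \<le> opt k)"
      using assms m_pos by (simp add: R0_def frame_def)
  next
    fix t s'
    assume "case s' of (R, M') \<Rightarrow> M' = M \<and> frame R \<and> R r_start < m \<and> R r_k \<le> m \<and>
          (\<forall>k < R r_k. opt (R r_start) \<le> opt k)"
      and "\<not> fst s' r_k < fst s' r_m" and "t \<le> 1 + (20 + 1) * (m - fst (R0, M) r_k)"
    then show "case s' of (R', M') \<Rightarrow> t \<le> 1 + 21 * m \<and> M' = M \<and>
      frame R' \<and> R' r_start < m \<and> (\<forall>k < m. opt (R' r_start) \<le> opt k)"
      by (cases s') (auto simp: frame_def R0_def)
  next
    fix R M'
    assume "case (R, M') of (R, M') \<Rightarrow> M' = M \<and> frame R \<and> R r_start < m \<and> R r_k \<le> m \<and>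
          (\<forall>k < R r_k. opt (R r_start) \<le> opt k)"
      and "R r_k < R r_m"
    moreover define k i where "k = R r_k" and "i = R r_start"
    ultimately have *: "M' = M" "frame R" "i < m" "k < m" "\<forall>k' < k. opt i \<le> opt k'"
      "R r_k = k" "R r_start = i"
      by (auto simp: frame_def)
    have ki: "k < m * n" "i < m * n" using *(3,4) m_le by linarith+
    have b: "base + m * n \<le> S" using n_le cells_pos unfolding base_def by linarith
    have w: "base + k < 2 ^ w" "base + k < S" "base + i < 2 ^ w" "base + i < S" "k < 2 ^ w" "Suc k < 2 ^ w"
      using word b * m_le by linarith+
    have v: "M (base + k) = opt k" "M (base + i) = opt i"
      using assms(2) ki by (simp_all add: table_def)
    have o: "opt k < 2 ^ w" "opt i < 2 ^ w" using ki by (auto intro!: opt_word)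
    have min: "opt k < opt i \<Longrightarrow> k' < Suc k \<Longrightarrow> opt k \<le> opt k'"
      "\<not> opt k < opt i \<Longrightarrow> k' < Suc k \<Longrightarrow> opt i \<le> opt k'" for k'
      using *(5) by (force simp: less_Suc_eq)+
    have "m - Suc k < m - k" using * by simp
    then show "run w S p (R, M') (\<lambda>t s'. t \<le> 20 \<and>
      (case s' of (R, M') \<Rightarrow> M' = M \<and> frame R \<and> R r_start < m \<and> R r_k \<le> m \<and>
          (\<forall>k < R r_k. opt (R r_start) \<le> opt k)) \<and> m - fst s' r_k < m - fst (R, M') r_k)"
      using * w v o min by (auto simp: p_def frame_def)
  qed
  have "frame R0" "R r_zero = 0" using assms(1) by (simp_all add: R0_def frame_def)
  then show ?thesis
    unfolding start_prog_def p_def[symmetric]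
    by (simp add: R0_def[symmetric]) (rule run_mono[OF loop], auto)
qed

text \<open>
  The invariant is phrased in terms of what is still to come: every optimal continuation of the
  current cell extends the pieces recorded so far to an optimal walk from \<open>i\<close>.
\<close>

definition traced :: "nat \<Rightarrow> state \<Rightarrow> bool" where
  "traced i = (\<lambda>(R, M). frame R \<and> table 0 M \<and> R r_start = i \<and> R r_k < m * n \<and>
     R r_len \<le> R r_k \<and> R r_pieces \<le> R r_k \<and>
     (\<exists>ps. length ps = R r_pieces \<and> (\<forall>a < length ps. M (a + 3) = ps ! a) \<and>
       (\<forall>x ls e. walk (R r_k) (x # ls) e (opt (R r_k)) \<longrightarrow>
          walk i (ps @ (x + R r_len) # ls) e (opt i))))"

text \<open>The rules of \<open>walk\<close> add a move in front, while the loop proceeds forward.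
  Since the invariant quantifies over continuations, one rule applied to a continuation from the new
  cell yields one from the old cell, to which the old invariant applies.\<close>

lemma trace_step:
  assumes "traced i (R, M)" "R r_k < m * n - m"
  shows "run w S (block
       [best_move_prog,
        IfLess r_kind r_one Skip
          (IfLess r_kind r_two (Op Plus r_len r_len r_one)
            (block [Op Plus r_a r_pieces r_three, Op Plus r_len r_len r_one, Store r_a r_len,
               Op Plus r_pieces r_pieces r_one, Op Plus r_len r_zero r_zero])),
        Op Plus r_k r_next r_zero]) (R, M)
    (\<lambda>t s'. t \<le> 60 \<and> traced i s' \<and> m * n - fst s' r_k < m * n - fst (R, M) r_k)"
proof -
  define k where "k = R r_k"
  from assms obtain ps where R: "frame R" "R r_start = i" "R r_k = k" and M: "table 0 M"
    and k: "k < m * n" "k < m * n - m" and len: "R r_len \<le> k" "R r_pieces \<le> k"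
    and ps: "length ps = R r_pieces" "\<And>a. a < R r_pieces \<Longrightarrow> M (a + 3) = ps ! a"
    and walk: "\<And>x ls e. walk k (x # ls) e (opt k) \<Longrightarrow> walk i (ps @ (x + R r_len) # ls) e (opt i)"
    by (auto simp: traced_def k_def)
  have best: "run w S best_move_prog (R, M) (\<lambda>t (R', M'). t \<le> 40 \<and> M' = M \<and>
    (\<forall>r. r \<notin> {r_val, r_next, r_kind, r_a, r_b, r_c} \<longrightarrow> R' r = R r) \<and>
    opt k = dis k + R' r_val \<and>
    (k < m * n - m \<longrightarrow> move k (R' r_kind) (R' r_next) \<and> opt (R' r_next) = R' r_val))"
    by (rule best_move_run) (use R M k in \<open>simp_all add: table_def\<close>)
  show ?thesis
    unfolding run_block_Cons[of w S best_move_prog]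
  proof (rule run_mono[OF best], clarify)
    fix t :: nat and R'
    assume t: "t \<le> 40"
      and R': "\<forall>r. r \<notin> {r_val, r_next, r_kind, r_a, r_b, r_c} \<longrightarrow> R' r = R r"
      and opt_k: "opt k = dis k + R' r_val"
      and "k < m * n - m \<longrightarrow> move k (R' r_kind) (R' r_next) \<and> opt (R' r_next) = R' r_val"
    moreover define k' where "k' = R' r_next"
    ultimately have move: "move k (R' r_kind) k'" and val: "opt k = dis k + opt k'"
      using k by auto
    have k': "k < k'" "k' < m * n" using move_less[OF move] move_bound[OF move k(2)] .
    have f: "frame R'" "R' r_start = i" "R' r_len = R r_len" "R' r_pieces = R r_pieces" "R' r_next = k'"
      using R R' by (simp_all add: frame_def k'_def)
    \<comment> \<open>Both counters grow by at most one per move while the cell number grows by at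
      least one. So \<open>r_pieces\<close> stays below \<open>m * n\<close>, and the length is
      stored below the table.\<close>
    have b: "base + m * n \<le> S" "R r_pieces + 3 < base"
      using n_le cells_pos len(2) k unfolding base_def by linarith+
    have w: "k' < 2 ^ w" "Suc (R r_len) < 2 ^ w" "R r_pieces + 3 < 2 ^ w" "R r_pieces + 3 < S"
      "Suc (R r_pieces) < 2 ^ w"
      using word b k' len by linarith+
    consider (down) "R' r_kind = 0" | (along) "R' r_kind = 1" | (wrap) "R' r_kind = 2"
      using move by (auto simp: move_def)
    then show "run w S (block
       [IfLess r_kind r_one Skip
          (IfLess r_kind r_two (Op Plus r_len r_len r_one)
            (block [Op Plus r_a r_pieces r_three, Op Plus r_len r_len r_one, Store r_a r_len,
               Op Plus r_pieces r_pieces r_one, Op Plus r_len r_zero r_zero])),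
        Op Plus r_k r_next r_zero]) (R', M)
      (\<lambda>t' s'. t + t' \<le> 60 \<and> traced i s' \<and> m * n - fst s' r_k < m * n - fst (R, M) r_k)"
    proof cases
      case down
      have "walk i (ps @ (x + R r_len) # ls) e (opt i)" if "walk k' (x # ls) e (opt k')" for x ls e
        using walk walk.down[OF move[unfolded down] that] val by simp
      then have "traced i (R'(r_k := k'), M)"
        using f M k' len ps by (auto simp: traced_def frame_def)
      then show ?thesis using down f w t k' R(3) by (simp add: frame_def)
    next
      case along
      have "walk i (ps @ (x + Suc (R r_len)) # ls) e (opt i)" if "walk k' (x # ls) e (opt k')" for x ls e
        using walk[of "Suc x"] walk.along[OF move[unfolded along] that] val by simp
      then have "traced i (R'(r_len := Suc (R r_len), r_k := k'), M)"
        using f M k' len ps by (auto simp: traced_def frame_def)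
      then show ?thesis using along f w t k' R(3) by (simp add: frame_def)
    next
      case wrap
      define M' where "M' = M(R r_pieces + 3 := Suc (R r_len))"
      \<comment> \<open>Before a wrap only the column of \<open>k\<close> is left of the current
        piece, so its length is \<open>1 + R r_len\<close>. The counter restarts at 0 because it
        omits the column of the current cell.\<close>
      have "walk i ((ps @ [Suc (R r_len)]) @ (x + 0) # ls) e (opt i)" if "walk k' (x # ls) e (opt k')" for x ls e
        using walk[of 1 "x # ls"] walk.wrap[OF move[unfolded wrap] that] val by simp
      moreover have "table 0 M'" unfolding M'_def by (rule table_upd_below[OF b(2) M])
      moreover have "M' (a + 3) = (ps @ [Suc (R r_len)]) ! a" if "a < Suc (R r_pieces)" for a
        using that ps by (auto simp: M'_def nth_append less_Suc_eq)
      ultimately have "traced i (R'(r_a := R r_pieces + 3, r_pieces := Suc (R r_pieces), r_len := 0,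
          r_k := k'), M')"
        using f k' len ps(1)
        by (auto simp: traced_def frame_def intro!: exI[of _ "ps @ [Suc (R r_len)]"])
      then show ?thesis using wrap f w t k' R(3)
        by (simp add: frame_def M'_def fun_upd_twist)
    qed
  qed
qed

lemma trace_run:
  assumes "frame R" "table 0 M" "R r_start < m"
  shows "run w S trace_prog (R, M) (\<lambda>t s'. t \<le> 10 + 61 * (m * n) \<and> traced (R r_start) s' \<and>
    m * n - m \<le> fst s' r_k)"
proof -
  define R0 where "R0 = R(r_k := R r_start, r_pieces := 0, r_len := 0)"
  define p where "p = block
       [best_move_prog,
        IfLess r_kind r_one Skip
          (IfLess r_kind r_two (Op Plus r_len r_len r_one)
            (block [Op Plus r_a r_pieces r_three, Op Plus r_len r_len r_one, Store r_a r_len,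
               Op Plus r_pieces r_pieces r_one, Op Plus r_len r_zero r_zero])),
        Op Plus r_k r_next r_zero]"
  have last: "fst s' r_last = m * n - m" if "traced i s'" for s' i
    using that by (cases s') (simp add: traced_def frame_def)
  have loop: "run w S (WhileLess r_k r_last p) (R0, M) (\<lambda>t s'. t \<le> 1 + 61 * (m * n) \<and>
    traced (R r_start) s' \<and> m * n - m \<le> fst s' r_k)"
  proof (rule run_WhileLess[where b = 60 and \<mu> = "\<lambda>s. m * n - fst s r_k" and I = "traced (R r_start)"])
    show "traced (R r_start) (R0, M)"
      \<comment> \<open>With no recorded pieces and \<open>r_len\<close> zero, the condition on
        continuations is trivial.\<close>
      using assms less_le_trans[OF assms(3) m_le] by (auto simp: traced_def R0_def frame_def)
  next
    fix t s'
    assume "traced (R r_start) s'" "\<not> fst s' r_k < fst s' r_last"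
      "t \<le> 1 + (60 + 1) * (m * n - fst (R0, M) r_k)"
    then show "t \<le> 1 + 61 * (m * n) \<and> traced (R r_start) s' \<and> m * n - m \<le> fst s' r_k"
      using last by auto
  next
    fix R1 M1
    assume *: "traced (R r_start) (R1, M1)" "R1 r_k < R1 r_last"
    then have "R1 r_k < m * n - m" using last by fastforce
    from trace_step[OF *(1) this]
    show "run w S p (R1, M1) (\<lambda>t s'. t \<le> 60 \<and> traced (R r_start) s' \<and>
      m * n - fst s' r_k < m * n - fst (R1, M1) r_k)"
      unfolding p_def .
  qed
  have "R r_zero = 0" "R r_start < 2 ^ w"
    using assms word m_le by (simp add: frame_def, linarith)
  then show ?thesis
    unfolding trace_prog_def p_def[symmetric]
    by (simp add: R0_def[symmetric]) (rule run_mono[OF loop], auto)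
qed

text \<open>In the last column stopping is an optimal continuation. Supplying it to the invariant
  closes the open piece and produces the walk of cost \<open>opt i\<close> that determines the
  solution.\<close>

lemma output_run:
  assumes "traced i (R, M)" "m * n - m \<le> R r_k" "i < m" "\<And>k'. k' < m \<Longrightarrow> opt i \<le> opt k'"
  shows "run w S output_prog (R, M) (\<lambda>t s. t \<le> 20 \<and>
    (\<exists>q. outputs s (output_words q) \<and> periodic_DTW_solution \<delta> A B q))"
proof -
  define k where "k = R r_k"
  from assms(1) obtain ps where R: "frame R" "R r_start = i" "R r_k = k"
    and k: "k < m * n" and len: "R r_len \<le> k" "R r_pieces \<le> k"
    and ps: "length ps = R r_pieces" "\<And>a. a < R r_pieces \<Longrightarrow> M (a + 3) = ps ! a"
    and walk: "\<And>x ls e. walk k (x # ls) e (opt k) \<Longrightarrow> walk i (ps @ (x + R r_len) # ls) e (opt i)"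
    by (auto simp: traced_def k_def)
  have last: "m * n - m \<le> k" using assms(2) by (simp add: k_def)
  \<comment> \<open>The row of \<open>k\<close> in the last column, counted from 1:
    \<open>k - (m * n - m)\<close> with the inner subtraction resolved.\<close>
  define e where "e = Suc (k + m - m * n)"
  have diff: "k - (m * n - m) = k + m - m * n" using m_le by (rule diff_diff_right)
  define ls where "ls = ps @ [Suc (R r_len)]"
  have "walk k [1] e (opt k)"
    using walk.finish[OF last k] last_column(2)[OF last k] by (simp add: e_def diff opt_last_column last)
  from walk[OF this] have "walk i ls e (opt i)" by (simp add: ls_def)
  from solution_of_walk[OF assms(3,4) this] obtain q where
    q: "output_words q = (length ls - 1) # (i + 1) # e # ls" "periodic_DTW_solution \<delta> A B q" .
  define M' where
    "M' = M(R r_pieces + 3 := Suc (R r_len), 0 := R r_pieces, Suc 0 := Suc i, 2 := e)"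
  have M': "M' (a + 3) = ls ! a" if "a < length ls" for a
    using that ps by (auto simp: M'_def ls_def nth_append less_Suc_eq)
  then have out: "outputs (R', M') (output_words q)" for R'
    unfolding outputs_def
  proof (intro allI impI)
    fix a assume a: "a < length (output_words q)"
    consider "a = 0" | "a = 1" | "a = 2" | b where "a = b + 3"
      by (metis One_nat_def add.commute le_add_diff_inverse less_2_cases not_less_eq_eq
          numeral_2_eq_2 numeral_3_eq_3 le_less_Suc_eq not_less)
    then show "snd (R', M') a = output_words q ! a"
    proof cases
      case 4
      with a have "b < length ls" by (simp add: q(1))
      then show ?thesis using M'[of b] 4 by (simp add: q(1) numeral_3_eq_3)
    qed (use ps(1) in \<open>simp_all add: q(1) M'_def ls_def\<close>)
  qed
  have "3 \<le> S" "R r_pieces + 3 < S" "R r_pieces + 3 < 2 ^ w" "Suc (R r_len) < 2 ^ w" "Suc i < 2 ^ w"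
    "Suc 0 < S" "2 < S" "0 < S" "e < 2 ^ w" "k + m - m * n < 2 ^ w"
    using word k len assms(3) cells_pos m_le unfolding e_def by linarith+
  moreover have "\<exists>q. outputs (R', M') (output_words q) \<and> periodic_DTW_solution \<delta> A B q" for R'
    using out q(2) by blast
  ultimately show ?thesis
    using R diff by (simp add: output_prog_def frame_def M'_def e_def)
qed

lemma periodic_DTW_run:
  "run w S periodic_DTW_prog (initial_state (input_words \<delta> A B)) (\<lambda>t s. t \<le> 300 * (m * n) \<and>
    (\<exists>q. outputs s (output_words q) \<and> periodic_DTW_solution \<delta> A B q))"
  unfolding periodic_DTW_prog_def run_block_Cons
proof (rule run_mono[OF setup_run], clarify)
  fix t1 :: nat and R1 M1
  assume t1: "t1 \<le> 20" and s1: "frame R1" "R1 r_k = m * n" "input M1"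
  show "run w S fill_prog (R1, M1) (\<lambda>t2 s2. run w S start_prog s2 (\<lambda>t3 s3.
    run w S trace_prog s3 (\<lambda>t4 s4. run w S output_prog s4 (\<lambda>t5 s5. run w S (block []) s5 (\<lambda>t6 s.
      t1 + (t2 + (t3 + (t4 + (t5 + t6)))) \<le> 300 * (m * n) \<and>
      (\<exists>q. outputs s (output_words q) \<and> periodic_DTW_solution \<delta> A B q))))))"
  proof (rule run_mono[OF fill_run[OF s1]], clarify)
    fix t2 :: nat and R2 M2
    assume t2: "t2 \<le> 1 + 61 * (m * n)" and s2: "frame R2" "table 0 M2"
    show "run w S start_prog (R2, M2) (\<lambda>t3 s3.
      run w S trace_prog s3 (\<lambda>t4 s4. run w S output_prog s4 (\<lambda>t5 s5. run w S (block []) s5 (\<lambda>t6 s.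
        t1 + (t2 + (t3 + (t4 + (t5 + t6)))) \<le> 300 * (m * n) \<and>
        (\<exists>q. outputs s (output_words q) \<and> periodic_DTW_solution \<delta> A B q)))))"
    proof (rule run_mono[OF start_run[OF s2]], clarify)
      fix t3 :: nat and R3
      assume t3: "t3 \<le> 10 + 21 * m" and s3: "frame R3" "R3 r_start < m"
        and min: "\<forall>k < m. opt (R3 r_start) \<le> opt k"
      show "run w S trace_prog (R3, M2) (\<lambda>t4 s4. run w S output_prog s4 (\<lambda>t5 s5.
        run w S (block []) s5 (\<lambda>t6 s.
          t1 + (t2 + (t3 + (t4 + (t5 + t6)))) \<le> 300 * (m * n) \<and>
          (\<exists>q. outputs s (output_words q) \<and> periodic_DTW_solution \<delta> A B q))))"
      proof (rule run_mono[OF trace_run[OF s3(1) s2(2) s3(2)]], clarify)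
        fix t4 :: nat and R4 M4
        assume t4: "t4 \<le> 10 + 61 * (m * n)" and s4: "traced (R3 r_start) (R4, M4)"
          "m * n - m \<le> fst (R4, M4) r_k"
        \<comment> \<open>The phases add up to at most \<open>62 + 122 * (m * n) + 21 * m\<close>,
          which is at most \<open>205 * (m * n)\<close>.\<close>
        have *: "t1 + (t2 + (t3 + (t4 + (t5 + 1)))) \<le> 300 * (m * n)" if "t5 \<le> 20" for t5
          using t1 t2 t3 t4 that cells_pos m_le by linarith
        show "run w S output_prog (R4, M4) (\<lambda>t5 s5. run w S (block []) s5 (\<lambda>t6 s.
          t1 + (t2 + (t3 + (t4 + (t5 + t6)))) \<le> 300 * (m * n) \<and>
          (\<exists>q. outputs s (output_words q) \<and> periodic_DTW_solution \<delta> A B q)))"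
        proof (rule run_mono[OF output_run[OF s4(1) _ s3(2)]])
          show "m * n - m \<le> R4 r_k" using s4(2) by simp
          show "opt (R3 r_start) \<le> opt k'" if "k' < m" for k' using min that by blast
        qed (use * in auto)
      qed
    qed
  qed
qed

end


section \<open>The bounds\<close>

theorem theorem5:
  fixes c :: nat
  shows "\<exists>(p :: prog) (T :: nat \<Rightarrow> nat \<Rightarrow> nat) (S :: nat \<Rightarrow> nat \<Rightarrow> nat) (w :: nat \<Rightarrow> nat \<Rightarrow> nat).
    (\<lambda>(m, n). real (T m n)) \<in> O[principal {(m, n). 1 \<le> m \<and> m \<le> n \<and> 2 \<le> n}](\<lambda>(m, n). max (real m * log 2 (real n)) (real n) * real n * log 2 (real n)) \<and>
    (\<lambda>(m, n). real (S m n)) \<in> O[principal {(m, n). 1 \<le> m \<and> m \<le> n}](\<lambda>(m, n). real m * real n) \<and>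
    (\<lambda>(m, n). real (w m n)) \<in> O[principal {(m, n). 1 \<le> m \<and> m \<le> n \<and> 2 \<le> n}](\<lambda>(m, n). log 2 (real n)) \<and>
    (\<forall>(\<delta> :: 'a \<Rightarrow> 'a \<Rightarrow> nat) (A :: 'a list) (B :: 'a list).
      A \<noteq> [] \<and> B \<noteq> [] \<and> length A \<le> length B \<and> (\<forall>a \<in> set A. \<forall>b \<in> set B. \<delta> a b \<le> c) \<longrightarrow>
      (\<exists>t s q.
        exec (w (length A) (length B)) (S (length A) (length B)) p
          (initial_state (input_words \<delta> A B)) t s \<and>
        t \<le> T (length A) (length B) \<and>
        outputs s (output_words q) \<and>
        periodic_DTW_solution \<delta> A B q))"
proof -
  \<comment> \<open>The factor \<open>2 ^ (c + 3)\<close> exceeds \<open>c + 6\<close>, and doubling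
    the rounded logarithm covers \<open>n * n\<close>, which is at least \<open>m * n\<close>
    because \<open>m \<le> n\<close>.\<close>
  define W :: "nat \<Rightarrow> nat \<Rightarrow> nat" where "W = (\<lambda>m n. c + 3 + 2 * nat \<lceil>log 2 (real n)\<rceil>)"
  have log_ge: "1 \<le> log 2 (real n)" if "2 \<le> n" for n :: nat
    using that by (simp add: le_log_iff)
  have T: "(\<lambda>(m, n). real (300 * (m * n))) \<in> O[principal {(m, n). 1 \<le> m \<and> m \<le> n \<and> 2 \<le> n}](
      \<lambda>(m, n). max (real m * log 2 (real n)) (real n) * real n * log 2 (real n))"
  proof (rule bigoI[where c = 300], unfold eventually_principal, clarify)
    fix m n :: nat assume mn: "1 \<le> m" "m \<le> n" "2 \<le> n"
    let ?L = "log 2 (real n)"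
    \<comment> \<open>From \<open>n \<ge> 2\<close> the logarithm is at least 1, so the maximum is
      at least \<open>m\<close> and the whole bound at least \<open>m * n\<close>.\<close>
    have "real m * 1 \<le> real m * ?L" using log_ge[OF mn(3)] by (intro mult_left_mono) auto
    then have "real m \<le> max (real m * ?L) (real n)" by linarith
    then have "real m * real n * 1 \<le> max (real m * ?L) (real n) * real n * ?L"
      using log_ge[OF mn(3)] by (intro mult_mono) auto
    then show "norm (real (300 * (m * n))) \<le> 300 * norm (max (real m * ?L) (real n) * real n * ?L)"
      by simp
  qed
  have S: "(\<lambda>(m, n). real (6 * (m * n))) \<in> O[principal {(m, n). 1 \<le> m \<and> m \<le> n}](\<lambda>(m, n). real m * real n)"
    by (rule bigoI[where c = 6]) (auto simp: eventually_principal)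
  have W: "(\<lambda>(m, n). real (W m n)) \<in> O[principal {(m, n). 1 \<le> m \<and> m \<le> n \<and> 2 \<le> n}](\<lambda>(m, n). log 2 (real n))"
  proof (rule bigoI[where c = "real c + 7"], unfold eventually_principal, clarify)
    fix m n :: nat assume mn: "1 \<le> m" "m \<le> n" "2 \<le> n"
    let ?L = "log 2 (real n)"
    have "real (nat \<lceil>?L\<rceil>) \<le> ?L + 1" using log_ge[OF mn(3)] by linarith
    then have "real (W m n) \<le> (real c + 5) * 1 + 2 * ?L" by (simp add: W_def)
    also have "\<dots> \<le> (real c + 5) * ?L + 2 * ?L"
      using log_ge[OF mn(3)] by (intro add_right_mono mult_left_mono) auto
    finally have "real (W m n) \<le> (real c + 7) * ?L" by (simp add: algebra_simps)
    then show "norm (real (W m n)) \<le> (real c + 7) * norm ?L" using log_ge[OF mn(3)] by simp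
  qed
  have word: "c * n + 6 * (m * n) < 2 ^ W m n" if mn: "1 \<le> m" "m \<le> n" for m n :: nat
  proof -
    let ?l = "nat \<lceil>log 2 (real n)\<rceil>"
    have "log 2 (real n) \<le> real ?l" by linarith
    moreover have "0 < real n" using mn by simp
    ultimately have "real n \<le> 2 powr real ?l" using log_le_iff[of 2 "real n" "real ?l"] by linarith
    then have "real n \<le> real (2 ^ ?l)" by (simp add: powr_realpow)
    then have n: "n \<le> 2 ^ ?l" by (simp only: of_nat_le_iff)
    have "(2::nat) ^ (c + 3) = 8 * 2 ^ c" by (simp add: power_add)
    then have "c + 6 < 2 ^ (c + 3)" using less_exp[of c] by linarith
    have "c * n + 6 * (m * n) \<le> (c + 6) * (n * n)"
    proof -
      have "n \<le> n * n" "m * n \<le> n * n" using mn by auto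
      then have "c * n \<le> c * (n * n)" "6 * (m * n) \<le> 6 * (n * n)" by (auto intro: mult_le_mono2)
      then show ?thesis unfolding add_mult_distrib by (rule add_mono)
    qed
    also have "\<dots> < 2 ^ (c + 3) * (n * n)"
      using \<open>c + 6 < 2 ^ (c + 3)\<close> mn by (intro mult_strict_right_mono) auto
    also have "\<dots> \<le> 2 ^ (c + 3) * (2 ^ ?l * 2 ^ ?l)"
      using n by (intro mult_le_mono) auto
    also have "\<dots> = 2 ^ W m n" by (simp only: W_def power_add mult_2)
    finally show ?thesis .
  qed
  have correct: "\<exists>t s q. exec (W (length A) (length B)) (6 * (length A * length B)) periodic_DTW_prog
      (initial_state (input_words \<delta> A B)) t s \<and> t \<le> 300 * (length A * length B) \<and>
      outputs s (output_words q) \<and> periodic_DTW_solution \<delta> A B q"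
    if "A \<noteq> []" "B \<noteq> []" "length A \<le> length B" "\<forall>a \<in> set A. \<forall>b \<in> set B. \<delta> a b \<le> c"
    for \<delta> :: "'a \<Rightarrow> 'a \<Rightarrow> nat" and A B :: "'a list"
  proof -
    have "1 \<le> length A" using that(1) by (simp add: Suc_le_eq)
    then interpret machine_instance \<delta> A B c "W (length A) (length B)"
      using that word by unfold_locales auto
    show ?thesis using periodic_DTW_run unfolding run_def by blast
  qed
  show ?thesis
    by (rule exI[of _ periodic_DTW_prog], rule exI[of _ "\<lambda>m n. 300 * (m * n)"],
        rule exI[of _ "\<lambda>m n. 6 * (m * n)"], rule exI[of _ W])
      (use T S W correct in blast)
qed

end
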